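(* Let $(\Omega,\mathcal{F})$ be a measurable space, $\mathcal{P}$ a nonempty set of probability measures on $(\Omega,\mathcal{F})$, and let $c$, $M_c$, $H_c$ be the associated sublinear expectation and Banach lattices. Let $\mathcal{Z}$ be the set of all sequences $(A_n)_{n\in\mathbb{N}}\subset\mathcal{F}$ such that $A_n\downarrow\emptyset$ and $c(A_n)\not\to 0$. Consider the following conditions: (i) $\mathcal{Z}=\emptyset$. (ii) $M_c^\ast\subset ca$. (iii) $H_c^\ast\subset ca$. Then (i) $\Longleftrightarrow$ (ii), and (iii) $\Longrightarrow$ (i). In particular, if $\mathcal{Z}=\emptyset$, then there exists a countable subset $\widetilde{\mathcal{P}}\subset\mathcal{P}$ such that $\widetilde{\mathcal{P}}\approx\mathcal{P}$, and thus there is a probability measure $Q$ on $(\Omega,\mathcal{F})$ such that $\{Q\}\approx\mathcal{P}$.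
   Context: $A_n\downarrow\emptyset$ means $A_n\supset A_{n+1}$ and $A_n\ne\emptyset$ for all $n\in\mathbb{N}$, and $\bigcap_{n}A_n=\emptyset$. For measurable $f:\Omega\to[0,\infty)$, $c(f):=\sup_{P\in\mathcal{P}}E_P[f]$, and $c(A):=c(1_A)$ for $A\in\mathcal{F}$. $L_c$ is the space of $\mathcal{F}$-measurable functions $\Omega\to\mathbb{R}$ modulo $\mathcal{P}$-q.s. equality ($f\sim g$ iff $P(f=g)=1$ for all $P\in\mathcal{P}$), with order $X\le Y$ iff $P(X\le Y)=1$ for all $P\in\mathcal{P}$. $L^\infty_c\subset L_c$ is the subspace of equivalence classes of bounded measurable functions. $H_c:=\{X\in L_c\mid c(|X|)<\infty\}$ with norm $\|X\|_c:=c(|X|)$ is a Banach lattice, and $M_c$ is the $\|\cdot\|_c$-closure of $L^\infty_c$ in $H_c$, with the same norm. $M_c^\ast,H_c^\ast$ denote the norm duals. $ca$ is the space of all $\sigma$-additive $\mu:\mathcal{F}\to\mathbb{R}$ (finite signed measures). For $B\in\{M_c,H_c\}$, $B^\ast\subset ca$ means that for every $l\in B^\ast$ there is $\mu\in ca$ such that $l(X)=\int X\,d\mu$ for all $X\in B$. For sets $\widehat{\mathcal{P}},\widetilde{\mathcal{P}}$ of probability measures on $(\Omega,\mathcal{F})$, $\widetilde{\mathcal{P}}\ll\widehat{\mathcal{P}}$ means: for all $A\in\mathcal{F}$, $\sup_{P\in\widehat{\mathcal{P}}}P(A)=0$ implies $\sup_{P\in\widetilde{\mathcal{P}}}P(A)=0$;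 $\widetilde{\mathcal{P}}\approx\widehat{\mathcal{P}}$ means $\widetilde{\mathcal{P}}\ll\widehat{\mathcal{P}}$ and $\widehat{\mathcal{P}}\ll\widetilde{\mathcal{P}}$. *)

theory Defs
  imports "HOL-Probability.Probability"
begin

text \<open>
  Throughout, \<open>M\<close> plays the role of the measurable space (only \<open>space M\<close> and \<open>sets M\<close> are used,
  the measure carried by \<open>M\<close> is irrelevant), and \<open>\<P>\<close> is a subset of \<open>space (prob_algebra M)\<close>,
  the set of all probability measures on that measurable space.
\<close>

text \<open>Intended for nonnegative measurable \<open>f\<close>; the value may be \<open>\<infinity>\<close>.\<close>

definition c_fun :: "'a measure set \<Rightarrow> ('a \<Rightarrow> real) \<Rightarrow> ennreal" where
  "c_fun \<P> f = (SUP P\<in>\<P>. \<integral>\<^sup>+x. ennreal (f x) \<partial>P)"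

definition c_set :: "'a measure set \<Rightarrow> 'a set \<Rightarrow> ennreal" where
  "c_set \<P> A = c_fun \<P> (indicator A)"

definition decreasing_to_empty :: "(nat \<Rightarrow> 'a set) \<Rightarrow> bool" where
  "decreasing_to_empty A \<longleftrightarrow> (\<forall>n. A (Suc n) \<subseteq> A n \<and> A n \<noteq> {}) \<and> (\<Inter>n. A n) = {}"

definition Z_seqs :: "'a measure \<Rightarrow> 'a measure set \<Rightarrow> (nat \<Rightarrow> 'a set) set" where
  "Z_seqs M \<P> = {A. range A \<subseteq> sets M \<and> decreasing_to_empty A
                    \<and> \<not> (\<lambda>n. c_set \<P> (A n)) \<longlonglongrightarrow> 0}"

definition qs_rel :: "'a measure \<Rightarrow> 'a measure set \<Rightarrow> (('a \<Rightarrow> real) \<times> ('a \<Rightarrow> real)) set" where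
  "qs_rel M \<P> = {(f, g). f \<in> borel_measurable M \<and> g \<in> borel_measurable M
                          \<and> (\<forall>P\<in>\<P>. AE x in P. f x = g x)}"

definition qs_class :: "'a measure \<Rightarrow> 'a measure set \<Rightarrow> ('a \<Rightarrow> real) \<Rightarrow> ('a \<Rightarrow> real) set" where
  "qs_class M \<P> f = qs_rel M \<P> `` {f}"

definition L_c :: "'a measure \<Rightarrow> 'a measure set \<Rightarrow> ('a \<Rightarrow> real) set set" where
  "L_c M \<P> = borel_measurable M // qs_rel M \<P>"

definition L_inf_c :: "'a measure \<Rightarrow> 'a measure set \<Rightarrow> ('a \<Rightarrow> real) set set" where
  "L_inf_c M \<P> = {qs_class M \<P> f |f. f \<in> borel_measurable M \<and> bounded (f ` space M)}"

text \<open>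
  The vector space operations on \<^term>\<open>L_c M \<P>\<close>. Each union runs over representatives,
  all of which contribute the same equivalence class.
\<close>

definition qs_add ::
  "'a measure \<Rightarrow> 'a measure set \<Rightarrow> ('a \<Rightarrow> real) set \<Rightarrow> ('a \<Rightarrow> real) set \<Rightarrow> ('a \<Rightarrow> real) set" where
  "qs_add M \<P> X Y = (\<Union>f\<in>X. \<Union>g\<in>Y. qs_class M \<P> (\<lambda>x. f x + g x))"

definition qs_scale ::
  "'a measure \<Rightarrow> 'a measure set \<Rightarrow> real \<Rightarrow> ('a \<Rightarrow> real) set \<Rightarrow> ('a \<Rightarrow> real) set" where
  "qs_scale M \<P> a X = (\<Union>f\<in>X. qs_class M \<P> (\<lambda>x. a * f x))"

definition qs_diff ::
  "'a measure \<Rightarrow> 'a measure set \<Rightarrow> ('a \<Rightarrow> real) set \<Rightarrow> ('a \<Rightarrow> real) set \<Rightarrow> ('a \<Rightarrow> real) set" where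
  "qs_diff M \<P> X Y = qs_add M \<P> X (qs_scale M \<P> (- 1) Y)"

text \<open>\<open>c(|X|)\<close> for a class \<open>X\<close>: the common value of \<open>c(|f|)\<close> over all representatives \<open>f\<close>.\<close>

definition c_abs :: "'a measure set \<Rightarrow> ('a \<Rightarrow> real) set \<Rightarrow> ennreal" where
  "c_abs \<P> X = the_elem ((\<lambda>f. c_fun \<P> (\<lambda>x. \<bar>f x\<bar>)) ` X)"

definition H_c :: "'a measure \<Rightarrow> 'a measure set \<Rightarrow> ('a \<Rightarrow> real) set set" where
  "H_c M \<P> = {X \<in> L_c M \<P>. c_abs \<P> X < \<infinity>}"

definition norm_c :: "'a measure set \<Rightarrow> ('a \<Rightarrow> real) set \<Rightarrow> real" where
  "norm_c \<P> X = enn2real (c_abs \<P> X)"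

definition M_c :: "'a measure \<Rightarrow> 'a measure set \<Rightarrow> ('a \<Rightarrow> real) set set" where
  "M_c M \<P> = {X \<in> H_c M \<P>. \<forall>e>0. \<exists>Y\<in>L_inf_c M \<P>. norm_c \<P> (qs_diff M \<P> X Y) < e}"

text \<open>Intended for linear subspaces \<open>B\<close> of \<^term>\<open>H_c M \<P>\<close>; values of \<open>l\<close> outside \<open>B\<close> are irrelevant.\<close>

definition norm_dual ::
  "'a measure \<Rightarrow> 'a measure set \<Rightarrow> ('a \<Rightarrow> real) set set \<Rightarrow> (('a \<Rightarrow> real) set \<Rightarrow> real) set" where
  "norm_dual M \<P> B = {l.
      (\<forall>X\<in>B. \<forall>Y\<in>B. l (qs_add M \<P> X Y) = l X + l Y) \<and>
      (\<forall>a. \<forall>X\<in>B. l (qs_scale M \<P> a X) = a * l X) \<and>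
      (\<exists>K. \<forall>X\<in>B. \<bar>l X\<bar> \<le> K * norm_c \<P> X)}"

definition ca :: "'a measure \<Rightarrow> ('a set \<Rightarrow> real) set" where
  "ca M = {\<mu>. \<mu> {} = 0 \<and>
      (\<forall>A::nat \<Rightarrow> 'a set. range A \<subseteq> sets M \<longrightarrow> disjoint_family A \<longrightarrow>
          (\<lambda>n. \<mu> (A n)) sums \<mu> (\<Union>n. A n))}"

text \<open>
  The positive part of the Jordan decomposition, \<open>\<mu>\<^sup>+(A) = sup {\<mu>(B) | B \<subseteq> A measurable}\<close>.
  Since \<open>B = {}\<close> is admitted, truncating negative values by \<^const>\<open>ennreal\<close> is harmless.
  The negative part is the positive part of \<open>- \<mu>\<close>.
\<close>

definition pos_var :: "'a measure \<Rightarrow> ('a set \<Rightarrow> real) \<Rightarrow> 'a measure" where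
  "pos_var M \<mu> = measure_of (space M) (sets M)
      (\<lambda>A. SUP B\<in>{B \<in> sets M. B \<subseteq> A}. ennreal (\<mu> B))"

definition neg_var :: "'a measure \<Rightarrow> ('a set \<Rightarrow> real) \<Rightarrow> 'a measure" where
  "neg_var M \<mu> = pos_var M (\<lambda>A. - \<mu> A)"

definition has_signed_integral ::
  "'a measure \<Rightarrow> ('a set \<Rightarrow> real) \<Rightarrow> ('a \<Rightarrow> real) \<Rightarrow> real \<Rightarrow> bool" where
  "has_signed_integral M \<mu> f r \<longleftrightarrow>
      integrable (pos_var M \<mu>) f \<and> integrable (neg_var M \<mu>) f \<and>
      r = (\<integral>x. f x \<partial>pos_var M \<mu>) - (\<integral>x. f x \<partial>neg_var M \<mu>)"

text \<open>
  \<open>B\<^sup>* \<subset> ca\<close>. For a class \<open>X\<close>, the identity \<open>l(X) = \<integral> X d\<mu>\<close> is required for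
  every representative of \<open>X\<close>, so that the right-hand side is well defined on classes.
\<close>

definition dual_in_ca :: "'a measure \<Rightarrow> 'a measure set \<Rightarrow> ('a \<Rightarrow> real) set set \<Rightarrow> bool" where
  "dual_in_ca M \<P> B \<longleftrightarrow>
      (\<forall>l\<in>norm_dual M \<P> B. \<exists>\<mu>\<in>ca M. \<forall>X\<in>B. \<forall>f\<in>X. has_signed_integral M \<mu> f (l X))"

definition dominated :: "'a measure \<Rightarrow> 'a measure set \<Rightarrow> 'a measure set \<Rightarrow> bool" where
  "dominated M \<Q> \<P> \<longleftrightarrow>
      (\<forall>A\<in>sets M. (SUP P\<in>\<P>. emeasure P A) = 0 \<longrightarrow> (SUP P\<in>\<Q>. emeasure P A) = 0)"

definition equivalent :: "'a measure \<Rightarrow> 'a measure set \<Rightarrow> 'a measure set \<Rightarrow> bool" where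
  "equivalent M \<Q> \<P> \<longleftrightarrow> dominated M \<Q> \<P> \<and> dominated M \<P> \<Q>"

end

theory Submission imports Defs begin

text \<open>
  If every \<open>A\<^sub>n \<down> \<emptyset>\<close> has \<open>c(A\<^sub>n) \<rightarrow> 0\<close>, then for a functional \<open>l\<close> on \<open>M\<^sub>c\<close> the set function
  \<open>\<mu>(A) = l(1\<^sub>A)\<close> is countably additive, and \<open>l\<close> and \<open>\<integral> \<cdot> d\<mu>\<close> agree on bounded functions by uniform
  approximation. A Hahn decomposition bounds \<open>\<integral> |f| d\<mu>\<^sup>\<plusminus>\<close> by \<open>\<parallel>l\<parallel> c(|f|)\<close>, so the representation extends
  to the closure.

  Conversely, let \<open>A\<^sub>n \<down> \<emptyset>\<close> and \<open>P\<^sub>n(A\<^sub>n) \<ge> \<epsilon> > 0\<close> with \<open>P\<^sub>n \<in> \<P>\<close>. By Tychonoff the functionals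
  \<open>E\<^bsub>P\<^sub>n\<^esub>\<close> have a pointwise cluster point \<open>l\<close>, which is a bounded functional with
  \<open>l(1\<^bsub>A\<^sub>m\<^esub>) \<ge> \<epsilon>\<close> for all \<open>m\<close>; no countably additive measure represents it.

  For the countable equivalent subset: were some \<open>\<epsilon>\<close> not controlled by the null sets of a finite
  subset of \<open>\<P>\<close>, one could choose inductively \<open>P\<^sub>n\<close> and \<open>A\<^sub>n\<close> with \<open>P\<^sub>n(A\<^sub>n) > \<epsilon>\<close> and
  \<open>P\<^sub>k(A\<^sub>n) = 0\<close> for \<open>k < n\<close>. Then \<open>limsup A\<^sub>n\<close> is null for every \<open>P\<^sub>k\<close>, and removing it from
  \<open>\<Union>\<^bsub>k \<ge> n\<^esub> A\<^sub>k\<close> gives sets decreasing to \<open>\<emptyset>\<close> of capacity above \<open>\<epsilon>\<close>.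
\<close>

subsection \<open>Signed measures and their variations\<close>

text \<open>Only an inequality, because on the right \<open>ennreal\<close> truncates negative terms
  to 0 before they can cancel positive ones.\<close>

lemma ennreal_sum_le: "ennreal (\<Sum>i\<in>I. x i) \<le> (\<Sum>i\<in>I. ennreal (x i))"
proof -
  have "ennreal (\<Sum>i\<in>I. x i) \<le> ennreal (\<Sum>i\<in>I. max 0 (x i))"
    by (intro ennreal_leI sum_mono) auto
  also have "\<dots> = (\<Sum>i\<in>I. ennreal (max 0 (x i)))"
    by (rule sum_ennreal[symmetric]) auto
  also have "\<dots> = (\<Sum>i\<in>I. ennreal (x i))"
    by (intro sum.cong) (auto simp: max_def ennreal_neg)
  finally show ?thesis .
qed

context
  fixes M :: "'a measure" and \<mu> :: "'a set \<Rightarrow> real"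
  assumes ca: "\<mu> \<in> ca M"
begin

lemma ca_empty: "\<mu> {} = 0"
  using ca by (simp add: ca_def)

lemma ca_sums:
  "range A \<subseteq> sets M \<Longrightarrow> disjoint_family A \<Longrightarrow> (\<lambda>n. \<mu> (A n)) sums \<mu> (\<Union>n. A n)"
  using ca by (simp add: ca_def)

lemma ca_Un:
  assumes "A \<in> sets M" "B \<in> sets M" "A \<inter> B = {}"
  shows "\<mu> (A \<union> B) = \<mu> A + \<mu> B"
proof -
  have "range (binaryset A B) \<subseteq> sets M" "disjoint_family (binaryset A B)"
    using assms by (auto simp: range_binaryset_eq disjoint_family_on_def binaryset_def)
  from ca_sums[OF this] have "(\<lambda>n. \<mu> (binaryset A B n)) sums \<mu> (A \<union> B)"
    by (simp add: UN_binaryset_eq)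
  moreover have "(\<lambda>n. \<mu> (binaryset A B n)) sums (\<mu> A + \<mu> B)"
    by (rule binaryset_sums) (rule ca_empty)
  ultimately show ?thesis
    by (rule sums_unique2)
qed

lemma ca_uminus: "(\<lambda>A. - \<mu> A) \<in> ca M"
  using ca by (auto simp: ca_def sums_minus)

text \<open>Near-optimal subsets of two disjoint sets are disjoint, so their union competes in the
  supremum for \<open>A \<union> B\<close>. Iterated over finitely many sets, this gives one half of
  the countable additivity below.\<close>

lemma pos_part_superadditive:
  assumes "A \<in> sets M" "B \<in> sets M" "A \<inter> B = {}"
  shows "(SUP C\<in>{C \<in> sets M. C \<subseteq> A}. ennreal (\<mu> C)) + (SUP C\<in>{C \<in> sets M. C \<subseteq> B}. ennreal (\<mu> C))
    \<le> (SUP C\<in>{C \<in> sets M. C \<subseteq> A \<union> B}. ennreal (\<mu> C))" (is "?s A + ?s B \<le> ?s (A \<union> B)")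
proof -
  have *: "ennreal (\<mu> C) + ennreal (\<mu> D) \<le> ?s (A \<union> B)"
    if C: "C \<in> sets M" "C \<subseteq> A" and D: "D \<in> sets M" "D \<subseteq> B" for C D
  proof -
    \<comment> \<open>A set of negative value is replaced by \<open>{}\<close>: the truncated value
      stays 0, and \<open>ennreal\<close> is additive on the nonnegative reals that remain.\<close>
    define C' where "C' = (if \<mu> C \<ge> 0 then C else {})"
    define D' where "D' = (if \<mu> D \<ge> 0 then D else {})"
    have "ennreal (\<mu> C) = ennreal (\<mu> C')" "ennreal (\<mu> D) = ennreal (\<mu> D')" "\<mu> C' \<ge> 0" "\<mu> D' \<ge> 0"
      by (auto simp: C'_def D'_def ca_empty ennreal_neg)
    moreover have "\<mu> (C' \<union> D') = \<mu> C' + \<mu> D'"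
      using C D assms by (intro ca_Un) (auto simp: C'_def D'_def)
    ultimately have "ennreal (\<mu> C) + ennreal (\<mu> D) = ennreal (\<mu> (C' \<union> D'))"
      by simp
    also have "\<dots> \<le> ?s (A \<union> B)"
      using C D by (intro SUP_upper) (auto simp: C'_def D'_def)
    finally show ?thesis .
  qed
  have ne: "{C \<in> sets M. C \<subseteq> X} \<noteq> {}" for X
    by auto
  show ?thesis
    by (simp only: ennreal_SUP_add_left[OF ne, symmetric] ennreal_SUP_add_right[OF ne])
      (intro SUP_least; use * in blast)
qed

text \<open>\<open>measure_of\<close> returns the prescribed set function only once that function is
  known to be countably additive. Superadditivity bounds all partial sums from above; conversely, a
  competitor \<open>C\<close> for the union is cut into the pieces \<open>C \<inter> A i\<close>,
  each of which competes for \<open>A i\<close>.\<close>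

lemma emeasure_pos_var:
  assumes A: "A \<in> sets M"
  shows "emeasure (pos_var M \<mu>) A = (SUP C\<in>{C \<in> sets M. C \<subseteq> A}. ennreal (\<mu> C))"
  unfolding pos_var_def
proof (rule emeasure_measure_of_sigma[OF sets.sigma_algebra_axioms _ _ A])
  let ?s = "\<lambda>A. SUP C\<in>{C \<in> sets M. C \<subseteq> A}. ennreal (\<mu> C)"
  have "{C \<in> sets M. C \<subseteq> {}} = {{}}"
    by auto
  then have empty: "?s {} = 0"
    by (simp add: ca_empty)
  then show "positive (sets M) ?s"
    by (simp add: positive_def)
  show "countably_additive (sets M) ?s"
  proof (rule countably_additiveI)
    fix A :: "nat \<Rightarrow> 'a set"
    assume A: "range A \<subseteq> sets M" "disjoint_family A" and U: "(\<Union>i. A i) \<in> sets M"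
    have fin: "(\<Sum>i<n. ?s (A i)) \<le> ?s (\<Union>i<n. A i)" for n
    proof (induction n)
      case (Suc n)
      have "(\<Sum>i<Suc n. ?s (A i)) \<le> ?s (\<Union>i<n. A i) + ?s (A n)"
        using Suc by (auto intro: add_right_mono)
      also have "\<dots> \<le> ?s ((\<Union>i<n. A i) \<union> A n)"
      proof (rule pos_part_superadditive)
        have "A i \<inter> A n = {}" if "i < n" for i
          using that by (intro disjoint_family_onD[OF A(2)]) auto
        then show "(\<Union>i<n. A i) \<inter> A n = {}"
          by blast
      qed (use A in auto)
      also have "(\<Union>i<n. A i) \<union> A n = (\<Union>i<Suc n. A i)"
        by (auto simp: lessThan_Suc)
      finally show ?case .
    qed (simp add: empty)
    show "(\<Sum>i. ?s (A i)) = ?s (\<Union>i. A i)"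
    proof (rule antisym)
      show "(\<Sum>i. ?s (A i)) \<le> ?s (\<Union>i. A i)"
      proof (rule suminf_le_const)
        fix n show "(\<Sum>i<n. ?s (A i)) \<le> ?s (\<Union>i. A i)"
          by (rule order.trans[OF fin], rule SUP_subset_mono) auto
      qed simp
      show "?s (\<Union>i. A i) \<le> (\<Sum>i. ?s (A i))"
      proof (rule SUP_least, clarify)
        fix C assume C: "C \<in> sets M" "C \<subseteq> (\<Union>i. A i)"
        have "(\<lambda>i. \<mu> (C \<inter> A i)) sums \<mu> (\<Union>i. C \<inter> A i)"
          using A C by (intro ca_sums) (auto simp: disjoint_family_on_def)
        also have "(\<Union>i. C \<inter> A i) = C"
          using C by auto
        finally have lim: "(\<lambda>n. ennreal (\<Sum>i<n. \<mu> (C \<inter> A i))) \<longlonglongrightarrow> ennreal (\<mu> C)"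
          by (auto simp: sums_def intro: tendsto_ennrealI)
        have "ennreal (\<Sum>i<n. \<mu> (C \<inter> A i)) \<le> (\<Sum>i. ?s (A i))" for n
        proof -
          have "ennreal (\<Sum>i<n. \<mu> (C \<inter> A i)) \<le> (\<Sum>i<n. ennreal (\<mu> (C \<inter> A i)))"
            by (rule ennreal_sum_le)
          also have "\<dots> \<le> (\<Sum>i<n. ?s (A i))"
            using A C by (intro sum_mono SUP_upper) auto
          also have "\<dots> \<le> (\<Sum>i. ?s (A i))"
            by (rule sum_le_suminf) auto
          finally show ?thesis .
        qed
        with lim show "ennreal (\<mu> C) \<le> (\<Sum>i. ?s (A i))"
          by (intro LIMSEQ_le_const2[OF lim]) auto
      qed
    qed
  qed
qed

end

lemma sets_pos_var [simp, measurable_cong]: "sets (pos_var M \<mu>) = sets M"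
  by (simp add: pos_var_def)

lemma space_pos_var [simp]: "space (pos_var M \<mu>) = space M"
  by (simp add: pos_var_def space_measure_of_conv)

lemma sets_neg_var [simp, measurable_cong]: "sets (neg_var M \<mu>) = sets M"
  by (simp add: neg_var_def)

lemma space_neg_var [simp]: "space (neg_var M \<mu>) = space M"
  by (simp add: neg_var_def)

lemma finite_measure_pos_var:
  assumes "\<mu> \<in> ca M" and bound: "\<And>A. A \<in> sets M \<Longrightarrow> \<bar>\<mu> A\<bar> \<le> K"
  shows "finite_measure (pos_var M \<mu>)"
proof (rule finite_measureI)
  have "emeasure (pos_var M \<mu>) (space M) \<le> ennreal K"
    unfolding emeasure_pos_var[OF assms(1) sets.top]
    by (intro SUP_least ennreal_leI) (use bound in \<open>force simp: abs_le_iff\<close>)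
  then show "emeasure (pos_var M \<mu>) (space (pos_var M \<mu>)) \<noteq> \<infinity>"
    by (auto simp: top_unique)
qed

lemma finite_measure_neg_var:
  assumes "\<mu> \<in> ca M" and "\<And>A. A \<in> sets M \<Longrightarrow> \<bar>\<mu> A\<bar> \<le> K"
  shows "finite_measure (neg_var M \<mu>)"
  unfolding neg_var_def by (rule finite_measure_pos_var[OF ca_uminus]) (use assms in auto)

text \<open>Jordan decomposition without a Hahn set: \<open>B\<close> and \<open>A - B\<close> run
  through the same measurable subsets of \<open>A\<close>, and
  \<open>\<mu> B = \<mu> A - \<mu> (A - B)\<close> turns the supremum for one variation into the
  supremum for the other, shifted by \<open>\<mu> A\<close>.\<close>

lemma pos_var_minus_neg_var:
  assumes ca: "\<mu> \<in> ca M" and fin: "finite_measure (pos_var M \<mu>)" "finite_measure (neg_var M \<mu>)"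
    and A: "A \<in> sets M"
  shows "\<mu> A = measure (pos_var M \<mu>) A - measure (neg_var M \<mu>) A"
proof -
  interpret p: finite_measure "pos_var M \<mu>" by fact
  interpret n: finite_measure "neg_var M \<mu>" by fact
  have pos: "\<mu> B \<le> measure (pos_var M \<mu>) A" and neg: "- \<mu> B \<le> measure (neg_var M \<mu>) A"
    if "B \<in> sets M" "B \<subseteq> A" for B
  proof -
    have "ennreal (\<mu> B) \<le> emeasure (pos_var M \<mu>) A"
      unfolding emeasure_pos_var[OF ca A] by (rule SUP_upper) (use that in auto)
    then show "\<mu> B \<le> measure (pos_var M \<mu>) A"
      by (simp add: p.emeasure_eq_measure)
    have "ennreal (- \<mu> B) \<le> emeasure (neg_var M \<mu>) A"
      unfolding neg_var_def emeasure_pos_var[OF ca_uminus[OF ca] A]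
      by (rule SUP_upper) (use that in auto)
    then show "- \<mu> B \<le> measure (neg_var M \<mu>) A"
      by (simp add: n.emeasure_eq_measure)
  qed
  have split: "\<mu> A = \<mu> B + \<mu> (A - B)" if "B \<in> sets M" "B \<subseteq> A" for B
  proof -
    have "\<mu> (B \<union> (A - B)) = \<mu> B + \<mu> (A - B)"
      by (rule ca_Un[OF ca]) (use that A in auto)
    moreover have "B \<union> (A - B) = A"
      using that by auto
    ultimately show ?thesis
      by simp
  qed
  have "emeasure (pos_var M \<mu>) A \<le> ennreal (\<mu> A + measure (neg_var M \<mu>) A)"
    unfolding emeasure_pos_var[OF ca A]
  proof (intro SUP_least ennreal_leI, clarify)
    fix B assume B: "B \<in> sets M" "B \<subseteq> A"
    then show "\<mu> B \<le> \<mu> A + measure (neg_var M \<mu>) A"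
      using split[OF B] neg[of "A - B"] A by auto
  qed
  then have "measure (pos_var M \<mu>) A \<le> \<mu> A + measure (neg_var M \<mu>) A"
    using neg[OF A] by (subst (asm) p.emeasure_eq_measure) (simp add: ennreal_le_iff)
  moreover have "emeasure (neg_var M \<mu>) A \<le> ennreal (measure (pos_var M \<mu>) A - \<mu> A)"
    unfolding neg_var_def emeasure_pos_var[OF ca_uminus[OF ca] A]
  proof (intro SUP_least ennreal_leI, clarify)
    fix B assume B: "B \<in> sets M" "B \<subseteq> A"
    then show "- \<mu> B \<le> measure (pos_var M \<mu>) A - \<mu> A"
      using split[OF B] pos[of "A - B"] A by auto
  qed
  then have "measure (neg_var M \<mu>) A \<le> measure (pos_var M \<mu>) A - \<mu> A"
    using pos[OF A] by (subst (asm) n.emeasure_eq_measure) (simp add: ennreal_le_iff)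
  ultimately show ?thesis
    by linarith
qed

section \<open>Compactness of pointwise bounded families of functionals\<close>

text \<open>Tychonoff makes the box of bounds compact, so the image filter of the sequence has a
  cluster point \<open>l\<close>. Intersecting with \<open>nhds l\<close> yields a finer filter that
  converges at every argument; a subsequence would not do, since the index type may be
  uncountable.\<close>

lemma pointwise_cluster_filter:
  fixes u :: "nat \<Rightarrow> 'b \<Rightarrow> real"
  assumes "\<And>n X. \<bar>u n X\<bar> \<le> K X"
  obtains G l where "G \<noteq> bot" "G \<le> filtermap u sequentially" "\<And>X. ((\<lambda>\<psi>. \<psi> X) \<longlongrightarrow> l X) G"
proof -
  let ?S = "PiE UNIV (\<lambda>X. {- K X..K X})"
  have "compactin (product_topology (\<lambda>_. euclidean) UNIV) ?S"
    by (simp add: compactin_PiE)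
  then have "compact ?S"
    by (simp add: euclidean_product_topology)
  moreover have "filtermap u sequentially \<noteq> bot"
    by (simp add: filtermap_bot_iff)
  moreover have "\<forall>\<^sub>F \<psi> in filtermap u sequentially. \<psi> \<in> ?S"
    using assms by (auto simp: eventually_filtermap abs_le_iff PiE_def Pi_def minus_le_iff)
  ultimately have "\<exists>l\<in>?S. inf (nhds l) (filtermap u sequentially) \<noteq> bot"
    unfolding compact_filter by simp
  then obtain l where l: "inf (nhds l) (filtermap u sequentially) \<noteq> bot"
    by (rule bexE)
  have "((\<lambda>\<psi>. \<psi> X) \<longlongrightarrow> l X) (inf (nhds l) (filtermap u sequentially))" for X
  proof -
    have "((\<lambda>\<psi>. \<psi> X) \<longlongrightarrow> l X) (nhds l)"
    proof (rule topological_tendstoI)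
      fix S assume "open S" "l X \<in> S"
      moreover from this have "open ((\<lambda>\<psi>. \<psi> X) -` S)"
        by (intro open_vimage) auto
      ultimately show "\<forall>\<^sub>F \<psi> in nhds l. \<psi> X \<in> S"
        unfolding eventually_nhds by (intro exI[of _ "(\<lambda>\<psi>. \<psi> X) -` S"]) auto
    qed
    then show ?thesis
      by (rule filterlim_mono) auto
  qed
  then show ?thesis
    by (rule that[OF l inf_le2])
qed

subsection \<open>Classes modulo quasi-sure equality\<close>

locale prob_family =
  fixes M :: "'a measure" and \<P> :: "'a measure set"
  assumes nonempty: "\<P> \<noteq> {}" and prob_algebra: "\<P> \<subseteq> space (prob_algebra M)"
begin

lemma prob_space: "P \<in> \<P> \<Longrightarrow> prob_space P"
  and sets_eq: "P \<in> \<P> \<Longrightarrow> sets P = sets M"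
  using prob_algebra by (auto simp: space_prob_algebra)

lemma space_eq: "P \<in> \<P> \<Longrightarrow> space P = space M"
  by (rule sets_eq_imp_space_eq) (rule sets_eq)

lemma borel_measurable_eq: "P \<in> \<P> \<Longrightarrow> borel_measurable P = borel_measurable M"
  by (rule measurable_cong_sets[OF sets_eq refl])

lemma equiv_qs_rel: "equiv (borel_measurable M) (qs_rel M \<P>)"
proof (rule equivI)
  show "trans (qs_rel M \<P>)"
  proof (rule transI)
    fix f g h assume fg: "(f, g) \<in> qs_rel M \<P>" and gh: "(g, h) \<in> qs_rel M \<P>"
    have "AE x in P. f x = h x" if "P \<in> \<P>" for P
    proof -
      have "AE x in P. f x = g x" "AE x in P. g x = h x"
        using fg gh that by (auto simp: qs_rel_def)
      then show ?thesis
        by eventually_elim simp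
    qed
    with fg gh show "(f, h) \<in> qs_rel M \<P>"
      by (simp add: qs_rel_def)
  qed
qed (auto simp: qs_rel_def refl_on_def intro!: symI elim: AE_mp)

lemma mem_qs_class:
  "g \<in> qs_class M \<P> f \<longleftrightarrow>
    f \<in> borel_measurable M \<and> g \<in> borel_measurable M \<and> (\<forall>P\<in>\<P>. AE x in P. f x = g x)"
  by (simp add: qs_class_def qs_rel_def)

lemma qs_class_self: "f \<in> borel_measurable M \<Longrightarrow> f \<in> qs_class M \<P> f"
  by (simp add: mem_qs_class)

lemma qs_class_eqI:
  "\<lbrakk>f \<in> borel_measurable M; g \<in> borel_measurable M; \<And>P. P \<in> \<P> \<Longrightarrow> AE x in P. f x = g x\<rbrakk>
    \<Longrightarrow> qs_class M \<P> f = qs_class M \<P> g"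
  unfolding qs_class_def
  by (rule equiv_class_eq[OF equiv_qs_rel]) (auto simp: qs_rel_def)

lemma qs_class_mem_eq: "f \<in> qs_class M \<P> g \<Longrightarrow> qs_class M \<P> f = qs_class M \<P> g"
  by (rule qs_class_eqI) (auto simp: mem_qs_class eq_commute)

lemma L_c_E:
  assumes "X \<in> L_c M \<P>"
  obtains f where "f \<in> borel_measurable M" "X = qs_class M \<P> f"
  using assms by (auto simp: L_c_def qs_class_def elim: quotientE)

lemma L_c_I: "f \<in> borel_measurable M \<Longrightarrow> qs_class M \<P> f \<in> L_c M \<P>"
  unfolding L_c_def qs_class_def by (rule quotientI)

text \<open>All representatives contribute one class, and measurability of \<open>f\<close> and
  \<open>g\<close> makes the classes nonempty, so the union collapses to that class.\<close>

lemma qs_add_class: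
  assumes [measurable]: "f \<in> borel_measurable M" "g \<in> borel_measurable M"
  shows "qs_add M \<P> (qs_class M \<P> f) (qs_class M \<P> g) = qs_class M \<P> (\<lambda>x. f x + g x)"
proof -
  have "qs_class M \<P> (\<lambda>x. f' x + g' x) = qs_class M \<P> (\<lambda>x. f x + g x)"
    if "f' \<in> qs_class M \<P> f" "g' \<in> qs_class M \<P> g" for f' g'
  proof (rule qs_class_eqI)
    show "AE x in P. f' x + g' x = f x + g x" if "P \<in> \<P>" for P
    proof -
      have "AE x in P. f x = f' x" "AE x in P. g x = g' x"
        using \<open>f' \<in> _\<close> \<open>g' \<in> _\<close> that by (auto simp: mem_qs_class)
      then show ?thesis
        by eventually_elim simp
    qed
  qed (use that in \<open>auto simp: mem_qs_class\<close>)
  then show ?thesis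
    using qs_class_self[OF assms(1)] qs_class_self[OF assms(2)] unfolding qs_add_def by blast
qed

lemma qs_scale_class:
  assumes [measurable]: "f \<in> borel_measurable M"
  shows "qs_scale M \<P> a (qs_class M \<P> f) = qs_class M \<P> (\<lambda>x. a * f x)"
proof -
  have "qs_class M \<P> (\<lambda>x. a * f' x) = qs_class M \<P> (\<lambda>x. a * f x)" if "f' \<in> qs_class M \<P> f" for f'
  proof (rule qs_class_eqI)
    show "AE x in P. a * f' x = a * f x" if "P \<in> \<P>" for P
    proof -
      have "AE x in P. f x = f' x"
        using \<open>f' \<in> _\<close> that by (auto simp: mem_qs_class)
      then show ?thesis
        by eventually_elim simp
    qed
  qed (use that in \<open>auto simp: mem_qs_class\<close>)
  then show ?thesis
    using qs_class_self[OF assms(1)] unfolding qs_scale_def by blast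
qed

lemma qs_diff_class:
  assumes [measurable]: "f \<in> borel_measurable M" "g \<in> borel_measurable M"
  shows "qs_diff M \<P> (qs_class M \<P> f) (qs_class M \<P> g) = qs_class M \<P> (\<lambda>x. f x - g x)"
  by (simp add: qs_diff_def qs_scale_class qs_add_class)

section \<open>Estimates for the sublinear expectation\<close>

lemma c_fun_mono:
  assumes "\<And>x. x \<in> space M \<Longrightarrow> f x \<le> g x"
  shows "c_fun \<P> f \<le> c_fun \<P> g"
  unfolding c_fun_def
proof (rule SUP_mono)
  fix P assume P: "P \<in> \<P>"
  then have "(\<integral>\<^sup>+x. ennreal (f x) \<partial>P) \<le> (\<integral>\<^sup>+x. ennreal (g x) \<partial>P)"
    using assms by (intro nn_integral_mono ennreal_leI) (simp add: space_eq)
  with P show "\<exists>Q\<in>\<P>. (\<integral>\<^sup>+x. ennreal (f x) \<partial>P) \<le> (\<integral>\<^sup>+x. ennreal (g x) \<partial>Q)"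
    by blast
qed

lemma c_fun_add:
  assumes [measurable]: "f \<in> borel_measurable M" "g \<in> borel_measurable M"
    and nn: "\<And>x. f x \<ge> 0" "\<And>x. g x \<ge> 0"
  shows "c_fun \<P> (\<lambda>x. f x + g x) \<le> c_fun \<P> f + c_fun \<P> g"
proof -
  have "(\<integral>\<^sup>+x. ennreal (f x + g x) \<partial>P) \<le> c_fun \<P> f + c_fun \<P> g" if P: "P \<in> \<P>" for P
  proof -
    have "(\<integral>\<^sup>+x. ennreal (f x + g x) \<partial>P) = (\<integral>\<^sup>+x. ennreal (f x) \<partial>P) + (\<integral>\<^sup>+x. ennreal (g x) \<partial>P)"
      using nn by (subst nn_integral_add[symmetric]) (simp_all add: borel_measurable_eq[OF P])
    also have "\<dots> \<le> c_fun \<P> f + c_fun \<P> g"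
      unfolding c_fun_def by (intro add_mono SUP_upper P)
    finally show ?thesis .
  qed
  then show ?thesis
    unfolding c_fun_def[of _ "\<lambda>x. f x + g x"] by (rule SUP_least)
qed

lemma c_fun_le_const:
  assumes "\<And>x. x \<in> space M \<Longrightarrow> f x \<le> b"
  shows "c_fun \<P> f \<le> ennreal b"
proof -
  have "(\<integral>\<^sup>+x. ennreal (f x) \<partial>P) \<le> ennreal b" if P: "P \<in> \<P>" for P
  proof -
    interpret prob_space P by (rule prob_space[OF P])
    have "(\<integral>\<^sup>+x. ennreal (f x) \<partial>P) \<le> (\<integral>\<^sup>+x. ennreal b \<partial>P)"
      by (intro nn_integral_mono ennreal_leI) (use assms in \<open>auto simp: space_eq[OF P]\<close>)
    also have "\<dots> = ennreal b"
      by (simp add: emeasure_space_1)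
    finally show ?thesis .
  qed
  then show ?thesis
    unfolding c_fun_def by (rule SUP_least)
qed

text \<open>Quasi-surely equal functions have the same integral under every
  \<open>P \<in> \<P>\<close>, so the image in \<open>c_abs\<close> is a singleton and
  \<open>the_elem\<close> is meaningful.\<close>

lemma c_abs_class:
  assumes f: "f \<in> borel_measurable M"
  shows "c_abs \<P> (qs_class M \<P> f) = c_fun \<P> (\<lambda>x. \<bar>f x\<bar>)"
proof -
  have "c_fun \<P> (\<lambda>x. \<bar>g x\<bar>) = c_fun \<P> (\<lambda>x. \<bar>f x\<bar>)" if "g \<in> qs_class M \<P> f" for g
    unfolding c_fun_def
  proof (intro SUP_cong refl nn_integral_cong_AE)
    fix P assume "P \<in> \<P>"
    then have "AE x in P. f x = g x"
      using that by (auto simp: mem_qs_class)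
    then show "AE x in P. ennreal \<bar>g x\<bar> = ennreal \<bar>f x\<bar>"
      by eventually_elim simp
  qed
  then have "(\<lambda>g. c_fun \<P> (\<lambda>x. \<bar>g x\<bar>)) ` qs_class M \<P> f = (\<lambda>_. c_fun \<P> (\<lambda>x. \<bar>f x\<bar>)) ` qs_class M \<P> f"
    by (rule image_cong[OF refl])
  also have "\<dots> = {c_fun \<P> (\<lambda>x. \<bar>f x\<bar>)}"
    using qs_class_self[OF f] by blast
  finally show ?thesis
    by (simp add: c_abs_def)
qed

section \<open>The norm and the spaces \<open>H_c\<close> and \<open>M_c\<close> in terms of
  representatives\<close>

lemma norm_c_class:
  "f \<in> borel_measurable M \<Longrightarrow> norm_c \<P> (qs_class M \<P> f) = enn2real (c_fun \<P> (\<lambda>x. \<bar>f x\<bar>))"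
  by (simp add: norm_c_def c_abs_class)

lemma H_c_class_iff:
  "f \<in> borel_measurable M \<Longrightarrow> qs_class M \<P> f \<in> H_c M \<P> \<longleftrightarrow> c_fun \<P> (\<lambda>x. \<bar>f x\<bar>) < \<infinity>"
  by (simp add: H_c_def c_abs_class L_c_I)

lemma H_c_E:
  assumes "X \<in> H_c M \<P>"
  obtains f where "f \<in> borel_measurable M" "X = qs_class M \<P> f" "c_fun \<P> (\<lambda>x. \<bar>f x\<bar>) < \<infinity>"
  using assms by (auto simp: H_c_def c_abs_class elim!: L_c_E)

lemma c_fun_abs_finite:
  assumes "bounded (f ` space M)"
  shows "c_fun \<P> (\<lambda>x. \<bar>f x\<bar>) < \<infinity>"
proof -
  obtain b where "\<And>x. x \<in> space M \<Longrightarrow> \<bar>f x\<bar> \<le> b"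
    using assms by (auto simp: bounded_iff)
  then have "c_fun \<P> (\<lambda>x. \<bar>f x\<bar>) \<le> ennreal b"
    by (rule c_fun_le_const)
  then show ?thesis
    using ennreal_less_top[of b] by (simp add: le_less_trans)
qed

lemma M_c_subset_H_c: "M_c M \<P> \<subseteq> H_c M \<P>"
  by (auto simp: M_c_def)

lemma M_c_class_iff:
  assumes f: "f \<in> borel_measurable M"
  shows "qs_class M \<P> f \<in> M_c M \<P> \<longleftrightarrow> c_fun \<P> (\<lambda>x. \<bar>f x\<bar>) < \<infinity> \<and>
    (\<forall>e>0. \<exists>g\<in>borel_measurable M. bounded (g ` space M) \<and>
      enn2real (c_fun \<P> (\<lambda>x. \<bar>f x - g x\<bar>)) < e)"
  (is "_ \<longleftrightarrow> _ \<and> (\<forall>e>0. ?R e)")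
proof -
  have "(\<exists>Y\<in>L_inf_c M \<P>. norm_c \<P> (qs_diff M \<P> (qs_class M \<P> f) Y) < e) \<longleftrightarrow> ?R e" for e
    using f by (auto simp: L_inf_c_def qs_diff_class norm_c_class)
  then show ?thesis
    by (simp add: M_c_def H_c_class_iff f)
qed

lemma L_inf_c_subset_M_c: "L_inf_c M \<P> \<subseteq> M_c M \<P>"
proof
  fix X assume "X \<in> L_inf_c M \<P>"
  then obtain f where f: "f \<in> borel_measurable M" "bounded (f ` space M)" "X = qs_class M \<P> f"
    by (auto simp: L_inf_c_def)
  have "c_fun \<P> (\<lambda>x. \<bar>f x - f x\<bar>) = 0"
    using nonempty by (simp add: c_fun_def)
  then show "X \<in> M_c M \<P>"
    using f c_fun_abs_finite[OF f(2)] by (auto simp: M_c_class_iff intro!: bexI[of _ f])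
qed

lemma bounded_class_in_M_c:
  "f \<in> borel_measurable M \<Longrightarrow> bounded (f ` space M) \<Longrightarrow> qs_class M \<P> f \<in> M_c M \<P>"
  using L_inf_c_subset_M_c by (auto simp: L_inf_c_def)

text \<open>If a bounded \<open>h\<close> approximates \<open>f\<close>, then the bounded function
  \<open>h - g\<close> approximates \<open>f - g\<close> with the same error.\<close>

lemma M_c_diff_bounded:
  assumes [measurable]: "f \<in> borel_measurable M" "g \<in> borel_measurable M"
    and f: "qs_class M \<P> f \<in> M_c M \<P>" and g: "bounded (g ` space M)"
  shows "qs_class M \<P> (\<lambda>x. f x - g x) \<in> M_c M \<P>"
proof -
  have "c_fun \<P> (\<lambda>x. \<bar>f x - g x\<bar>) \<le> c_fun \<P> (\<lambda>x. \<bar>f x\<bar> + \<bar>g x\<bar>)"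
    by (rule c_fun_mono) auto
  also have "\<dots> \<le> c_fun \<P> (\<lambda>x. \<bar>f x\<bar>) + c_fun \<P> (\<lambda>x. \<bar>g x\<bar>)"
    by (rule c_fun_add) auto
  also have "\<dots> < \<infinity>"
    using f c_fun_abs_finite[OF g] by (simp add: M_c_class_iff)
  finally have "c_fun \<P> (\<lambda>x. \<bar>f x - g x\<bar>) < \<infinity>" .
  moreover have "\<exists>h\<in>borel_measurable M. bounded (h ` space M) \<and>
      enn2real (c_fun \<P> (\<lambda>x. \<bar>f x - g x - h x\<bar>)) < e" if "e > 0" for e
  proof -
    obtain h where h: "h \<in> borel_measurable M" "bounded (h ` space M)"
        "enn2real (c_fun \<P> (\<lambda>x. \<bar>f x - h x\<bar>)) < e"
      using f \<open>e > 0\<close> by (auto simp: M_c_class_iff)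
    have "bounded ((\<lambda>x. h x - g x) ` space M)"
      using h(2) g by (rule bounded_minus_comp)
    then show ?thesis
      using h by (intro bexI[of _ "\<lambda>x. h x - g x"]) auto
  qed
  ultimately show ?thesis
    by (simp add: M_c_class_iff)
qed

section \<open>The capacity of sets\<close>

lemma c_set_eq: "A \<in> sets M \<Longrightarrow> c_set \<P> A = (SUP P\<in>\<P>. emeasure P A)"
  unfolding c_set_def c_fun_def by (intro SUP_cong refl) (simp add: ennreal_indicator sets_eq)

lemma c_set_mono: "A \<subseteq> B \<Longrightarrow> c_set \<P> A \<le> c_set \<P> B"
  unfolding c_set_def by (rule c_fun_mono) (auto simp: indicator_def)

lemma c_set_empty: "c_set \<P> {} = 0"
  using nonempty by (simp add: c_set_def c_fun_def)

text \<open>Sequences in \<open>Z_seqs\<close> have nonempty members. A decreasing sequence that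
  reaches \<open>{}\<close> is therefore treated separately; its capacities are eventually
  0.\<close>

lemma c_set_tendsto_0:
  assumes Z: "Z_seqs M \<P> = {}" and A: "range A \<subseteq> sets M" "decseq A" "(\<Inter>n. A n) = {}"
  shows "(\<lambda>n. c_set \<P> (A n)) \<longlonglongrightarrow> 0"
proof (cases "\<exists>n. A n = {}")
  case True
  then obtain n where n: "A n = {}" ..
  have "A m = {}" if "m \<ge> n" for m
    using decseqD[OF A(2) that] n by auto
  then show ?thesis
    by (intro tendsto_eventually eventually_sequentiallyI[of n]) (simp add: c_set_empty)
next
  case False
  then have "decreasing_to_empty A"
    using A by (auto simp: decreasing_to_empty_def decseq_Suc_iff)
  then show ?thesis
    using Z A by (auto simp: Z_seqs_def)
qed

end

subsection \<open>Failure of representability\<close>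

lemma finite_measure_if_integrable_one:
  assumes "integrable M (\<lambda>_. 1 :: real)"
  shows "finite_measure M"
proof (rule finite_measureI)
  have "(\<integral>\<^sup>+x. ennreal (norm (1 :: real)) \<partial>M) < \<infinity>"
    using assms unfolding integrable_iff_bounded by blast
  then show "emeasure M (space M) \<noteq> \<infinity>"
    by (simp add: less_top)
qed

context prob_family
begin

text \<open>Each expectation under a member of \<open>\<P>\<close> is thus a functional of norm at
  most 1 on \<open>H_c\<close>.\<close>

lemma integrable_of_c_fun_finite:
  assumes P: "P \<in> \<P>" and f: "f \<in> borel_measurable M" and fin: "c_fun \<P> (\<lambda>x. \<bar>f x\<bar>) < \<infinity>"
  shows "integrable P f" and "\<bar>\<integral>x. f x \<partial>P\<bar> \<le> enn2real (c_fun \<P> (\<lambda>x. \<bar>f x\<bar>))"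
proof -
  have le: "(\<integral>\<^sup>+x. ennreal \<bar>f x\<bar> \<partial>P) \<le> c_fun \<P> (\<lambda>x. \<bar>f x\<bar>)"
    unfolding c_fun_def using P by (rule SUP_upper)
  show int: "integrable P f"
    using f le fin by (auto simp: integrable_iff_bounded borel_measurable_eq[OF P] le_less_trans)
  have "\<bar>\<integral>x. f x \<partial>P\<bar> \<le> (\<integral>x. \<bar>f x\<bar> \<partial>P)"
    by (rule integral_abs_bound)
  also have "\<dots> = enn2real (\<integral>\<^sup>+x. ennreal \<bar>f x\<bar> \<partial>P)"
    using int by (intro integral_eq_nn_integral) auto
  also have "\<dots> \<le> enn2real (c_fun \<P> (\<lambda>x. \<bar>f x\<bar>))"
    using le fin by (intro enn2real_mono) auto
  finally show "\<bar>\<integral>x. f x \<partial>P\<bar> \<le> enn2real (c_fun \<P> (\<lambda>x. \<bar>f x\<bar>))" .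
qed

lemma c_fun_abs_add_finite:
  assumes [measurable]: "f \<in> borel_measurable M" "g \<in> borel_measurable M"
    and fg: "c_fun \<P> (\<lambda>x. \<bar>f x\<bar>) < \<infinity>" "c_fun \<P> (\<lambda>x. \<bar>g x\<bar>) < \<infinity>"
  shows "c_fun \<P> (\<lambda>x. \<bar>f x + g x\<bar>) < \<infinity>"
proof -
  have "c_fun \<P> (\<lambda>x. \<bar>f x + g x\<bar>) \<le> c_fun \<P> (\<lambda>x. \<bar>f x\<bar> + \<bar>g x\<bar>)"
    by (rule c_fun_mono) auto
  also have "\<dots> \<le> c_fun \<P> (\<lambda>x. \<bar>f x\<bar>) + c_fun \<P> (\<lambda>x. \<bar>g x\<bar>)"
    by (rule c_fun_add) auto
  also have "\<dots> < \<infinity>"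
    using fg by simp
  finally show ?thesis .
qed

lemma c_fun_abs_scale_finite:
  assumes [measurable]: "f \<in> borel_measurable M"
    and f: "c_fun \<P> (\<lambda>x. \<bar>f x\<bar>) < \<infinity>"
  shows "c_fun \<P> (\<lambda>x. \<bar>a * f x\<bar>) < \<infinity>"
proof -
  have "c_fun \<P> (\<lambda>x. \<bar>a * f x\<bar>) \<le> ennreal \<bar>a\<bar> * c_fun \<P> (\<lambda>x. \<bar>f x\<bar>)"
    unfolding c_fun_def[of _ "\<lambda>x. \<bar>a * f x\<bar>"]
  proof (rule SUP_least)
    fix P assume P: "P \<in> \<P>"
    have "(\<integral>\<^sup>+x. ennreal \<bar>a * f x\<bar> \<partial>P) = ennreal \<bar>a\<bar> * (\<integral>\<^sup>+x. ennreal \<bar>f x\<bar> \<partial>P)"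
      by (simp add: abs_mult ennreal_mult nn_integral_cmult borel_measurable_eq[OF P])
    also have "\<dots> \<le> ennreal \<bar>a\<bar> * c_fun \<P> (\<lambda>x. \<bar>f x\<bar>)"
      unfolding c_fun_def by (intro mult_left_mono SUP_upper P) auto
    finally show "(\<integral>\<^sup>+x. ennreal \<bar>a * f x\<bar> \<partial>P) \<le> ennreal \<bar>a\<bar> * c_fun \<P> (\<lambda>x. \<bar>f x\<bar>)" .
  qed
  also have "\<dots> < \<infinity>"
    using f by (simp add: ennreal_mult_less_top)
  finally show ?thesis .
qed

text \<open>Stated for any \<open>B\<close> between \<open>L_inf_c\<close> and \<open>H_c\<close>,
  so that the same argument serves \<open>M_c\<close> and \<open>H_c\<close>. Bounded functions
  suffice to produce the contradiction, as only indicators and the constant 1 are tested.\<close>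

lemma Z_seqs_empty_if_dual_in_ca:
  assumes "L_inf_c M \<P> \<subseteq> B" "B \<subseteq> H_c M \<P>" and dual: "dual_in_ca M \<P> B"
  shows "Z_seqs M \<P> = {}"
proof (rule ccontr)
  assume "Z_seqs M \<P> \<noteq> {}"
  then obtain A where A: "range A \<subseteq> sets M" "decreasing_to_empty A"
      and not_lim: "\<not> (\<lambda>n. c_set \<P> (A n)) \<longlonglongrightarrow> 0"
    by (auto simp: Z_seqs_def)
  have sets_A [measurable]: "A n \<in> sets M" for n
    using A by auto
  have dec: "decseq A" and Inter: "(\<Inter>n. A n) = {}"
    using A by (auto simp: decreasing_to_empty_def decseq_Suc_iff)
  \<comment> \<open>Decreasing capacities converge to their infimum, so failure to tend to 0 leaves
    a positive lower bound valid for all \<open>n\<close>.\<close>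
  have "decseq (\<lambda>n. c_set \<P> (A n))"
    using dec by (auto simp: decseq_def intro: c_set_mono)
  then have "(\<lambda>n. c_set \<P> (A n)) \<longlonglongrightarrow> (INF n. c_set \<P> (A n))"
    by (rule LIMSEQ_INF)
  with not_lim have "0 < (INF n. c_set \<P> (A n))"
    by (metis not_gr_zero)
  then obtain d where d: "0 < d" "d < (INF n. c_set \<P> (A n))"
    using dense by blast
  then obtain \<epsilon> where \<epsilon>: "d = ennreal \<epsilon>" "\<epsilon> > 0"
    by (cases d) (auto simp: top_unique ennreal_less_zero_iff)
  have "\<exists>P\<in>\<P>. d < emeasure P (A n)" for n
  proof -
    have "d < c_set \<P> (A n)"
      using d(2) by (rule less_le_trans) (rule INF_lower, simp)
    then show ?thesis
      by (simp add: c_set_eq less_SUP_iff)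
  qed
  then obtain P where P: "\<And>n. P n \<in> \<P>" and PA: "\<And>n. d < emeasure (P n) (A n)"
    by metis
  \<comment> \<open>For fixed \<open>m\<close> the bound holds for all later \<open>n\<close>,
    because \<open>A n \<subseteq> A m\<close>; this is what survives in the limit along
    \<open>G\<close>.\<close>
  have large: "\<epsilon> \<le> measure (P n) (A m)" if "m \<le> n" for m n
  proof -
    interpret prob_space "P n" by (rule prob_space[OF P])
    have "ennreal \<epsilon> \<le> emeasure (P n) (A n)"
      using PA[of n] \<epsilon> by simp
    also have "\<dots> \<le> emeasure (P n) (A m)"
      by (intro emeasure_mono decseqD[OF dec that]) (simp add: sets_eq[OF P])
    finally show ?thesis
      by (simp add: emeasure_eq_measure)
  qed
  \<comment> \<open>Expectation under \<open>P n\<close> as a function of classes, through a chosen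
    representative. The default 0 outside \<open>H_c\<close> keeps \<open>u n X\<close> bounded by
    \<open>norm_c \<P> X\<close> for every \<open>X\<close>, as compactness requires.\<close>
  define u where "u n X = (if X \<in> H_c M \<P> then \<integral>x. (SOME f. f \<in> X) x \<partial>P n else 0)" for n X
  have u: "u n (qs_class M \<P> f) = (\<integral>x. f x \<partial>P n)"
    if "f \<in> borel_measurable M" "c_fun \<P> (\<lambda>x. \<bar>f x\<bar>) < \<infinity>" for n f
  proof -
    let ?g = "SOME g. g \<in> qs_class M \<P> f"
    have "?g \<in> qs_class M \<P> f"
      by (rule someI[where P = "\<lambda>g. g \<in> qs_class M \<P> f", OF qs_class_self[OF that(1)]])
    then have "?g \<in> borel_measurable M" "AE x in P n. f x = ?g x"
      using P by (auto simp: mem_qs_class)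
    then have "(\<integral>x. f x \<partial>P n) = (\<integral>x. ?g x \<partial>P n)"
      using that by (intro integral_cong_AE) (auto simp: borel_measurable_eq[OF P])
    then show ?thesis
      using that by (simp add: u_def H_c_class_iff)
  qed
  have u_bound: "\<bar>u n X\<bar> \<le> norm_c \<P> X" for n X
  proof (cases "X \<in> H_c M \<P>")
    case True
    then show ?thesis
      using integrable_of_c_fun_finite(2)[OF P] by (elim H_c_E) (simp add: u norm_c_class)
  next
    case False
    then show ?thesis
      by (simp add: u_def norm_c_def)
  qed
  obtain G l where G: "G \<noteq> bot" "G \<le> filtermap u sequentially"
      and l: "\<And>X. ((\<lambda>\<psi>. \<psi> X) \<longlongrightarrow> l X) G"
    using pointwise_cluster_filter[of u, OF u_bound] by blast
  \<comment> \<open>Whatever holds for all late members of the sequence holds eventually along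
    \<open>G\<close>. Linearity and the norm bound then pass to \<open>l\<close> as closed
    conditions.\<close>
  have G_I: "\<forall>\<^sub>F \<psi> in G. Q \<psi>" if "\<And>n. n \<ge> m \<Longrightarrow> Q (u n)" for Q m
  proof (rule filter_leD[OF G(2)])
    show "\<forall>\<^sub>F \<psi> in filtermap u sequentially. Q \<psi>"
      using that by (auto simp: eventually_filtermap eventually_sequentially)
  qed
  have "l \<in> norm_dual M \<P> B"
    unfolding norm_dual_def
  proof (intro CollectI conjI ballI allI exI)
    fix X Y assume "X \<in> B" "Y \<in> B"
    then have "X \<in> H_c M \<P>" "Y \<in> H_c M \<P>"
      using assms by auto
    from H_c_E[OF this(1)] obtain f where f [measurable]: "f \<in> borel_measurable M"
        and X: "X = qs_class M \<P> f" and f_fin: "c_fun \<P> (\<lambda>x. \<bar>f x\<bar>) < \<infinity>" .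
    from H_c_E[OF \<open>Y \<in> H_c M \<P>\<close>] obtain g where g [measurable]: "g \<in> borel_measurable M"
        and Y: "Y = qs_class M \<P> g" and g_fin: "c_fun \<P> (\<lambda>x. \<bar>g x\<bar>) < \<infinity>" .
    have "u n (qs_add M \<P> X Y) = u n X + u n Y" for n
      unfolding X Y qs_add_class[OF f g] u[OF f f_fin] u[OF g g_fin]
        u[OF borel_measurable_add[OF f g] c_fun_abs_add_finite[OF f g f_fin g_fin]]
      by (intro Bochner_Integration.integral_add integrable_of_c_fun_finite(1)[OF P] f g f_fin g_fin)
    then have "\<forall>\<^sub>F \<psi> in G. \<psi> (qs_add M \<P> X Y) = \<psi> X + \<psi> Y"
      by (intro G_I)
    then have "((\<lambda>\<psi>. \<psi> X + \<psi> Y) \<longlongrightarrow> l (qs_add M \<P> X Y)) G"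
      by (rule Lim_transform_eventually[OF l])
    with G(1) show "l (qs_add M \<P> X Y) = l X + l Y"
      by (rule tendsto_unique) (intro tendsto_add l)
  next
    fix a X assume "X \<in> B"
    then have "X \<in> H_c M \<P>"
      using assms by auto
    from H_c_E[OF this] obtain f where f [measurable]: "f \<in> borel_measurable M"
        and X: "X = qs_class M \<P> f" and fin: "c_fun \<P> (\<lambda>x. \<bar>f x\<bar>) < \<infinity>" .
    have "u n (qs_scale M \<P> a X) = a * u n X" for n
      unfolding X qs_scale_class[OF f] u[OF f fin]
      by (subst u) (use c_fun_abs_scale_finite[OF f fin] in simp_all)
    then have "\<forall>\<^sub>F \<psi> in G. \<psi> (qs_scale M \<P> a X) = a * \<psi> X"
      by (intro G_I)
    then have "((\<lambda>\<psi>. a * \<psi> X) \<longlongrightarrow> l (qs_scale M \<P> a X)) G"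
      by (rule Lim_transform_eventually[OF l])
    with G(1) show "l (qs_scale M \<P> a X) = a * l X"
      by (rule tendsto_unique) (intro tendsto_mult_left l)
  next
    fix X assume "X \<in> B"
    have "\<forall>\<^sub>F \<psi> in G. \<bar>\<psi> X\<bar> \<le> norm_c \<P> X"
      by (intro G_I[of 0] u_bound)
    with tendsto_rabs[OF l[of X]] have "\<bar>l X\<bar> \<le> norm_c \<P> X"
      by (rule tendsto_upperbound) (rule G(1))
    then show "\<bar>l X\<bar> \<le> 1 * norm_c \<P> X"
      by simp
  qed
  then obtain \<mu> where \<mu>: "\<mu> \<in> ca M"
      "\<And>X f. X \<in> B \<Longrightarrow> f \<in> X \<Longrightarrow> has_signed_integral M \<mu> f (l X)"
    using dual unfolding dual_in_ca_def by blast
  have \<mu>_class: "has_signed_integral M \<mu> f (l (qs_class M \<P> f))"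
    if "f \<in> borel_measurable M" "bounded (f ` space M)" for f
    using assms(1) that by (intro \<mu>(2) qs_class_self) (auto simp: L_inf_c_def)
  have fin: "c_fun \<P> (\<lambda>x. \<bar>indicator (A m) x :: real\<bar>) < \<infinity>"
    and bnd: "bounded ((indicator (A m) :: 'a \<Rightarrow> real) ` space M)" for m
  proof -
    show "bounded ((indicator (A m) :: 'a \<Rightarrow> real) ` space M)"
      by (rule boundedI[of _ 1]) (auto simp: indicator_def)
    then show "c_fun \<P> (\<lambda>x. \<bar>indicator (A m) x :: real\<bar>) < \<infinity>"
      by (rule c_fun_abs_finite)
  qed
  \<comment> \<open>Integrability of the constant 1 makes both variations finite, which gives
    continuity from above along \<open>A\<close>.\<close>
  have "has_signed_integral M \<mu> (\<lambda>_. 1) (l (qs_class M \<P> (\<lambda>_. 1)))"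
    by (intro \<mu>_class) (auto intro: boundedI[of _ 1])
  then have one: "integrable (pos_var M \<mu>) (\<lambda>_. 1 :: real)" "integrable (neg_var M \<mu>) (\<lambda>_. 1 :: real)"
    by (auto simp: has_signed_integral_def)
  interpret p: finite_measure "pos_var M \<mu>"
    by (rule finite_measure_if_integrable_one[OF one(1)])
  interpret n: finite_measure "neg_var M \<mu>"
    by (rule finite_measure_if_integrable_one[OF one(2)])
  have "l (qs_class M \<P> (indicator (A m))) = measure (pos_var M \<mu>) (A m) - measure (neg_var M \<mu>) (A m)"
    for m
    using \<mu>_class[OF _ bnd, of m] sets.sets_into_space[OF sets_A]
    by (simp add: has_signed_integral_def Int_absorb2)
  moreover have "(\<lambda>m. measure (pos_var M \<mu>) (A m) - measure (neg_var M \<mu>) (A m)) \<longlonglongrightarrow>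
      measure (pos_var M \<mu>) (\<Inter>n. A n) - measure (neg_var M \<mu>) (\<Inter>n. A n)"
    using A(1) dec by (intro tendsto_diff p.finite_Lim_measure_decseq n.finite_Lim_measure_decseq) auto
  ultimately have "(\<lambda>m. l (qs_class M \<P> (indicator (A m)))) \<longlonglongrightarrow> 0"
    by (simp add: Inter)
  moreover have "\<epsilon> \<le> l (qs_class M \<P> (indicator (A m)))" for m
  proof -
    have "u n (qs_class M \<P> (indicator (A m))) = measure (P n) (A m)" for n
      using fin[of m] sets.sets_into_space[OF sets_A[of m]]
      by (simp add: u Int_absorb2 space_eq[OF P] sets_eq[OF P])
    then have "\<forall>\<^sub>F \<psi> in G. \<epsilon> \<le> \<psi> (qs_class M \<P> (indicator (A m)))"
      using large by (intro G_I[of m]) simp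
    with l show ?thesis
      by (rule tendsto_lowerbound) (rule G(1))
  qed
  ultimately have "\<epsilon> \<le> 0"
    by (intro LIMSEQ_le_const) auto
  with \<open>\<epsilon> > 0\<close> show False
    by simp
qed

end

subsection \<open>Representation of the dual of \<open>M\<^sub>c\<close>\<close>

text \<open>Round \<open>f\<close> down to a multiple of \<open>e\<close>. The level sets of
  \<open>\<lfloor>f x / e\<rfloor>\<close> are measurable, and boundedness of \<open>f\<close>
  leaves only finitely many values.\<close>

lemma uniform_approx_by_indicators:
  assumes [measurable]: "f \<in> borel_measurable M" and bdd: "bounded (f ` space M)" and "e > (0::real)"
  shows "\<exists>(S :: int set) A a. finite S \<and> range A \<subseteq> sets M \<and>
    (\<forall>x\<in>space M. \<bar>f x - (\<Sum>k\<in>S. a k * indicator (A k) x)\<bar> \<le> e)"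
proof -
  obtain b where b: "\<And>x. x \<in> space M \<Longrightarrow> \<bar>f x\<bar> \<le> b"
    using bdd by (auto simp: bounded_iff)
  let ?S = "{\<lfloor>- b / e\<rfloor>..\<lfloor>b / e\<rfloor>}" and ?A = "\<lambda>k. {x \<in> space M. \<lfloor>f x / e\<rfloor> = k}"
  show ?thesis
  proof (rule exI[of _ ?S], rule exI[of _ ?A], rule exI[of _ "\<lambda>k. of_int k * e"], intro conjI ballI)
    fix x assume x: "x \<in> space M"
    have "- b / e \<le> f x / e" "f x / e \<le> b / e"
      by (rule divide_right_mono; use b[OF x] \<open>e > 0\<close> in simp)+
    then have "\<lfloor>f x / e\<rfloor> \<in> ?S"
      by (auto intro!: floor_mono)
    then have "(\<Sum>k\<in>?S. (of_int k * e) * indicator (?A k) x) = of_int \<lfloor>f x / e\<rfloor> * e"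
      using x by (subst sum.remove[of _ "\<lfloor>f x / e\<rfloor>"]) (auto intro!: sum.neutral)
    moreover have "of_int \<lfloor>f x / e\<rfloor> * e \<le> f x" "f x \<le> (of_int \<lfloor>f x / e\<rfloor> + 1) * e"
      using floor_correct[of "f x / e"] \<open>e > 0\<close>
        pos_le_divide_eq[of e "of_int \<lfloor>f x / e\<rfloor>" "f x"] pos_divide_less_eq[of e "f x" "of_int \<lfloor>f x / e\<rfloor> + 1"]
      by linarith+
    ultimately show "\<bar>f x - (\<Sum>k\<in>?S. (of_int k * e) * indicator (?A k) x)\<bar> \<le> e"
      by (simp add: algebra_simps abs_le_iff)
  qed auto
qed

lemma (in finite_measure) integral_abs_le_const:
  fixes f :: "'a \<Rightarrow> real"
  assumes f: "f \<in> borel_measurable M" and b: "\<And>x. x \<in> space M \<Longrightarrow> \<bar>f x\<bar> \<le> b"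
  shows "integrable M f" and "\<bar>\<integral>x. f x \<partial>M\<bar> \<le> b * measure M (space M)"
proof -
  show int: "integrable M f"
    using f b by (intro integrable_const_bound[of _ b]) auto
  have "\<bar>\<integral>x. f x \<partial>M\<bar> \<le> (\<integral>x. \<bar>f x\<bar> \<partial>M)"
    by (rule integral_abs_bound)
  also have "\<dots> \<le> (\<integral>x. b \<partial>M)"
    using int b by (intro integral_mono) auto
  finally show "\<bar>\<integral>x. f x \<partial>M\<bar> \<le> b * measure M (space M)"
    by (simp add: mult.commute)
qed

lemma (in finite_measure) integral_indicator_sum:
  fixes a :: "'b \<Rightarrow> real"
  assumes A: "\<And>k. A k \<in> sets M"
  shows "integrable M (\<lambda>x. \<Sum>k\<in>S. a k * indicator (A k) x)"
    and "(\<integral>x. (\<Sum>k\<in>S. a k * indicator (A k) x) \<partial>M) = (\<Sum>k\<in>S. a k * measure M (A k))"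
proof -
  have int: "integrable M (\<lambda>x. a k * indicator (A k) x)" for k
    using A by (intro integrable_mult_right integrable_real_indicator) (auto simp: less_top[symmetric])
  then show "integrable M (\<lambda>x. \<Sum>k\<in>S. a k * indicator (A k) x)"
    by (intro Bochner_Integration.integrable_sum)
  have eq: "(\<integral>x. a k * indicator (A k) x \<partial>M) = a k * measure M (A k)" for k
    using sets.sets_into_space[OF A[of k]] by (simp add: Int_absorb2)
  then show "(\<integral>x. (\<Sum>k\<in>S. a k * indicator (A k) x) \<partial>M) = (\<Sum>k\<in>S. a k * measure M (A k))"
    by (simp only: Bochner_Integration.integral_sum[OF int] eq)
qed

lemma bounded_indicator_sum:
  assumes "finite S"
  shows "bounded ((\<lambda>x. \<Sum>k\<in>S. a k * indicator (A k) x :: real) ` X)"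
proof (rule boundedI)
  fix y assume "y \<in> (\<lambda>x. \<Sum>k\<in>S. a k * indicator (A k) x :: real) ` X"
  then obtain x where "y = (\<Sum>k\<in>S. a k * indicator (A k) x)"
    by auto
  then have "norm y \<le> (\<Sum>k\<in>S. norm (a k * indicator (A k) x))"
    by (simp add: sum_norm_le)
  also have "\<dots> \<le> (\<Sum>k\<in>S. \<bar>a k\<bar>)"
    by (intro sum_mono) (auto simp: indicator_def)
  finally show "norm y \<le> (\<Sum>k\<in>S. \<bar>a k\<bar>)" .
qed

lemma bounded_indicator: "bounded ((indicator A :: 'a \<Rightarrow> real) ` X)"
  by (rule boundedI[of _ 1]) (auto simp: indicator_def)

section \<open>A bounded functional on \<open>M_c\<close> and its set function\<close>

text \<open>A locale, so that results about the positive variation can be instantiated at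
  \<open>-l\<close> to obtain those about the negative variation.\<close>

locale M_c_functional = prob_family +
  fixes l :: "('a \<Rightarrow> real) set \<Rightarrow> real" and K :: real
  assumes add: "\<And>X Y. X \<in> M_c M \<P> \<Longrightarrow> Y \<in> M_c M \<P> \<Longrightarrow> l (qs_add M \<P> X Y) = l X + l Y"
    and scale: "\<And>a X. X \<in> M_c M \<P> \<Longrightarrow> l (qs_scale M \<P> a X) = a * l X"
    and bound: "\<And>X. X \<in> M_c M \<P> \<Longrightarrow> \<bar>l X\<bar> \<le> K * norm_c \<P> X"
    and K_nonneg: "K \<ge> 0"
    and Z_empty: "Z_seqs M \<P> = {}"
begin

definition functional_measure :: "'a set \<Rightarrow> real" where
  "functional_measure A = l (qs_class M \<P> (indicator A))"

lemma add_class: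
  assumes "f \<in> borel_measurable M" "g \<in> borel_measurable M"
    and "qs_class M \<P> f \<in> M_c M \<P>" "qs_class M \<P> g \<in> M_c M \<P>"
  shows "l (qs_class M \<P> (\<lambda>x. f x + g x)) = l (qs_class M \<P> f) + l (qs_class M \<P> g)"
  using assms add by (metis qs_add_class)

lemma scale_class:
  assumes "f \<in> borel_measurable M" and "qs_class M \<P> f \<in> M_c M \<P>"
  shows "l (qs_class M \<P> (\<lambda>x. a * f x)) = a * l (qs_class M \<P> f)"
  using assms scale by (metis qs_scale_class)

lemma diff_bounded_class:
  assumes f: "f \<in> borel_measurable M" "qs_class M \<P> f \<in> M_c M \<P>"
    and g: "g \<in> borel_measurable M" "bounded (g ` space M)"
  shows "l (qs_class M \<P> (\<lambda>x. f x - g x)) = l (qs_class M \<P> f) - l (qs_class M \<P> g)"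
proof -
  have "l (qs_class M \<P> (\<lambda>x. (f x - g x) + g x)) = l (qs_class M \<P> (\<lambda>x. f x - g x)) + l (qs_class M \<P> g)"
    by (rule add_class) (use assms in \<open>auto intro: M_c_diff_bounded bounded_class_in_M_c\<close>)
  then show ?thesis
    by simp
qed

lemma bound_class:
  "f \<in> borel_measurable M \<Longrightarrow> qs_class M \<P> f \<in> M_c M \<P> \<Longrightarrow>
    \<bar>l (qs_class M \<P> f)\<bar> \<le> K * enn2real (c_fun \<P> (\<lambda>x. \<bar>f x\<bar>))"
  using bound[of "qs_class M \<P> f"] by (simp add: norm_c_class)

lemma bound_const:
  assumes f: "f \<in> borel_measurable M" and b: "\<And>x. x \<in> space M \<Longrightarrow> \<bar>f x\<bar> \<le> b" "b \<ge> 0"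
  shows "\<bar>l (qs_class M \<P> f)\<bar> \<le> K * b"
proof -
  have "bounded (f ` space M)"
    using b by (auto simp: bounded_iff)
  then have "\<bar>l (qs_class M \<P> f)\<bar> \<le> K * enn2real (c_fun \<P> (\<lambda>x. \<bar>f x\<bar>))"
    by (intro bound_class bounded_class_in_M_c f)
  also have "\<dots> \<le> K * b"
    using K_nonneg b by (intro mult_left_mono enn2real_leI c_fun_le_const) auto
  finally show ?thesis .
qed

lemma indicator_sum:
  assumes "finite S" and [measurable]: "\<And>k. A k \<in> sets M"
  shows "l (qs_class M \<P> (\<lambda>x. \<Sum>k\<in>S. a k * indicator (A k) x)) = (\<Sum>k\<in>S. a k * functional_measure (A k))"
  using assms(1)
proof (induction S rule: finite_induct)
  case empty
  \<comment> \<open>The zero class is written as a multiple by 0, so homogeneity gives the value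
    0.\<close>
  have "l (qs_class M \<P> (\<lambda>x. 0 * 0)) = 0 * l (qs_class M \<P> (\<lambda>x. 0))"
    by (intro scale_class bounded_class_in_M_c) (auto intro: boundedI[of _ 0])
  then show ?case
    by simp
next
  case (insert k S)
  have "l (qs_class M \<P> (\<lambda>x. a k * indicator (A k) x)) = a k * functional_measure (A k)"
    unfolding functional_measure_def
    by (intro scale_class bounded_class_in_M_c bounded_indicator) auto
  moreover have "l (qs_class M \<P> (\<lambda>x. a k * indicator (A k) x + (\<Sum>k\<in>S. a k * indicator (A k) x))) =
      l (qs_class M \<P> (\<lambda>x. a k * indicator (A k) x)) + l (qs_class M \<P> (\<lambda>x. \<Sum>k\<in>S. a k * indicator (A k) x))"
  proof (intro add_class bounded_class_in_M_c)
    show "bounded ((\<lambda>x. a k * indicator (A k) x) ` space M)"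
      by (rule boundedI[of _ "\<bar>a k\<bar>"]) (auto simp: indicator_def)
  qed (use bounded_indicator_sum[OF insert.hyps(1)] in auto)
  ultimately show ?case
    using insert.IH by (simp only: sum.insert[OF insert.hyps])
qed

lemma functional_measure_le:
  assumes A: "A \<in> sets M"
  shows "\<bar>functional_measure A\<bar> \<le> K"
  using bound_const[of "indicator A" 1] A by (auto simp: functional_measure_def indicator_def[abs_def])

lemma functional_measure_UN:
  assumes "finite S" and A [measurable]: "\<And>k. A k \<in> sets M" and disj: "disjoint_family_on A S"
  shows "functional_measure (\<Union>k\<in>S. A k) = (\<Sum>k\<in>S. functional_measure (A k))"
proof -
  have "indicator (\<Union>k\<in>S. A k) = (\<lambda>x. \<Sum>k\<in>S. 1 * indicator (A k) x :: real)"
    by (rule ext) (simp add: indicator_UN_disjoint[OF assms(1) disj])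
  then have "functional_measure (\<Union>k\<in>S. A k) = l (qs_class M \<P> (\<lambda>x. \<Sum>k\<in>S. 1 * indicator (A k) x))"
    by (simp only: functional_measure_def)
  also have "\<dots> = (\<Sum>k\<in>S. 1 * functional_measure (A k))"
    by (rule indicator_sum) (use assms in auto)
  finally show ?thesis
    by simp
qed

text \<open>The remainder of the series is the value on the tail union \<open>R n\<close>. The tails
  decrease to the empty set, so the assumption on \<open>Z_seqs\<close> makes
  \<open>K * c(R n)\<close>, and with it the remainder, tend to 0.\<close>

lemma functional_measure_ca: "functional_measure \<in> ca M"
  unfolding ca_def
proof (intro CollectI conjI allI impI)
  show empty: "functional_measure {} = 0"
    using functional_measure_UN[of "{}" "\<lambda>_. {}"] by (simp add: disjoint_family_on_def)
  fix A :: "nat \<Rightarrow> 'a set" assume A: "range A \<subseteq> sets M" "disjoint_family A"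
  have A_sets [measurable]: "A k \<in> sets M" for k
    using A by auto
  define R where "R n = (\<Union>k\<in>{n..}. A k)" for n
  have R_sets [measurable]: "R n \<in> sets M" for n
    unfolding R_def by auto
  have "(\<Inter>n. R n) = {}"
  proof (rule ccontr)
    assume "(\<Inter>n. R n) \<noteq> {}"
    then obtain x where x: "\<And>n. x \<in> R n"
      by auto
    \<comment> \<open>A point lies in at most one \<open>A k\<close>, hence it has left the tail
      starting at \<open>Suc k\<close>.\<close>
    from x[of 0] obtain k where "x \<in> A k"
      by (auto simp: R_def)
    moreover from x[of "Suc k"] obtain j where "j > k" "x \<in> A j"
      by (auto simp: R_def Suc_le_eq)
    ultimately show False
      using disjoint_family_onD[OF A(2), of k j] by auto
  qed
  moreover have "decseq R"
    unfolding decseq_def R_def by (intro allI impI UN_mono) auto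
  ultimately have "(\<lambda>n. c_set \<P> (R n)) \<longlonglongrightarrow> 0"
    using R_sets by (intro c_set_tendsto_0 Z_empty) auto
  then have "(\<lambda>n. enn2real (c_set \<P> (R n))) \<longlonglongrightarrow> 0"
    by (intro tendsto_enn2real[where l = 0, simplified])
  then have lim: "(\<lambda>n. K * enn2real (c_set \<P> (R n))) \<longlonglongrightarrow> 0"
    by (rule tendsto_mult_right_zero)
  have diff: "\<bar>functional_measure (R n)\<bar> \<le> K * enn2real (c_set \<P> (R n))" for n
    using bound_class[OF _ bounded_class_in_M_c[OF _ bounded_indicator], of "R n"]
    by (simp add: functional_measure_def c_set_def)
  have "functional_measure (\<Union>k. A k) - (\<Sum>k<n. functional_measure (A k)) = functional_measure (R n)" for n
  proof -
    \<comment> \<open>The first \<open>n\<close> sets followed by the tail in position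
      \<open>n\<close>: \<open>n + 1\<close> disjoint sets with the full union, to which finite
      additivity applies.\<close>
    define B where "B = (\<lambda>k. if k < n then A k else R n)"
    have disj: "disjoint_family_on B {..n}"
      unfolding disjoint_family_on_def
    proof (intro ballI impI)
      have *: "A i \<inter> R n = {}" if "i < n" for i
      proof -
        have "A i \<inter> A j = {}" if "n \<le> j" for j
          using disjoint_family_onD[OF A(2), of i j] \<open>i < n\<close> that by auto
        then show ?thesis
          by (auto simp: R_def)
      qed
      fix i j assume "i \<in> {..n}" "j \<in> {..n}" "i \<noteq> j"
      then consider "i < n" "j < n" | "i < n" "j = n" | "i = n" "j < n"
        by fastforce
      then show "B i \<inter> B j = {}"
        using *[of i] *[of j] disjoint_family_onD[OF A(2), of i j] \<open>i \<noteq> j\<close>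
        by cases (simp_all add: B_def Int_commute)
    qed
    have "(\<Union>k. A k) = (\<Union>k\<in>{..n}. B k)"
    proof (intro set_eqI iffI)
      fix x assume "x \<in> (\<Union>k. A k)"
      then obtain k where k: "x \<in> A k"
        by auto
      show "x \<in> (\<Union>k\<in>{..n}. B k)"
      proof (cases "k < n")
        case True
        with k show ?thesis
          by (intro UN_I[of k]) (auto simp: B_def)
      next
        case False
        with k show ?thesis
          by (intro UN_I[of n]) (auto simp: B_def R_def)
      qed
    qed (auto simp: B_def R_def split: if_splits)
    then have "functional_measure (\<Union>k. A k) = (\<Sum>k\<le>n. functional_measure (B k))"
      using functional_measure_UN[OF _ _ disj] by (simp add: B_def)
    also have "\<dots> = (\<Sum>k<n. functional_measure (A k)) + functional_measure (R n)"
      by (simp add: B_def lessThan_Suc_atMost[symmetric])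
    finally show ?thesis
      by simp
  qed
  with diff have "(\<lambda>n. functional_measure (\<Union>k. A k) - (\<Sum>k<n. functional_measure (A k))) \<longlonglongrightarrow> 0"
    by (intro Lim_null_comparison[OF _ lim]) auto
  from tendsto_diff[OF tendsto_const[of "functional_measure (\<Union>k. A k)"] this]
  show "(\<lambda>k. functional_measure (A k)) sums functional_measure (\<Union>k. A k)"
    by (simp add: sums_def)
qed

section \<open>Integration against the Jordan variations\<close>

abbreviation "\<mu>p \<equiv> pos_var M functional_measure"
abbreviation "\<mu>n \<equiv> neg_var M functional_measure"

lemma finite_\<mu>p: "finite_measure \<mu>p"
  by (rule finite_measure_pos_var[OF functional_measure_ca functional_measure_le])

lemma finite_\<mu>n: "finite_measure \<mu>n"
  by (rule finite_measure_neg_var[OF functional_measure_ca functional_measure_le])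

lemma functional_measure_eq: "A \<in> sets M \<Longrightarrow> functional_measure A = measure \<mu>p A - measure \<mu>n A"
  by (rule pos_var_minus_neg_var[OF functional_measure_ca finite_\<mu>p finite_\<mu>n])

text \<open>Linearity settles finite combinations of indicators. A uniform error \<open>e\<close>
  changes \<open>l\<close> by at most \<open>K * e\<close> and each integral by at most
  \<open>e\<close> times the total mass; \<open>C\<close> collects these three constants.\<close>

lemma bounded_class_eq_integral:
  assumes f [measurable]: "f \<in> borel_measurable M" and bdd: "bounded (f ` space M)"
  shows "l (qs_class M \<P> f) = (\<integral>x. f x \<partial>\<mu>p) - (\<integral>x. f x \<partial>\<mu>n)" (is "_ = ?I f")
proof -
  interpret p: finite_measure \<mu>p by (rule finite_\<mu>p)
  interpret n: finite_measure \<mu>n by (rule finite_\<mu>n)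
  define C where "C = K + measure \<mu>p (space M) + measure \<mu>n (space M)"
  have "C \<ge> 0"
    using K_nonneg by (simp add: C_def)
  obtain b where b: "\<And>x. x \<in> space M \<Longrightarrow> \<bar>f x\<bar> \<le> b"
    using bdd by (auto simp: bounded_iff)
  have close: "\<bar>l (qs_class M \<P> f) - ?I f\<bar> \<le> e * C" if "e > 0" for e
  proof -
    from uniform_approx_by_indicators[OF f bdd \<open>e > 0\<close>]
    obtain S :: "int set" and A a where S: "finite S" and range_A: "range A \<subseteq> sets M"
      and approx: "\<forall>x\<in>space M. \<bar>f x - (\<Sum>k\<in>S. a k * indicator (A k) x)\<bar> \<le> e"
      by (elim exE conjE)
    have A [measurable]: "A k \<in> sets M" for k
      using range_A by auto
    define g where "g = (\<lambda>x. \<Sum>k\<in>S. a k * indicator (A k) x)"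
    have g [measurable]: "g \<in> borel_measurable M" and g_bdd: "bounded (g ` space M)"
      unfolding g_def by (measurable, rule bounded_indicator_sum[OF S])
    have int_f: "integrable \<mu>p f" "integrable \<mu>n f"
      using b by (auto intro!: p.integral_abs_le_const n.integral_abs_le_const)
    have int_g: "integrable \<mu>p g" "integrable \<mu>n g"
      and I_g: "?I g = (\<Sum>k\<in>S. a k * functional_measure (A k))"
      unfolding g_def
      by (simp_all only: p.integral_indicator_sum[unfolded sets_pos_var, OF A]
          n.integral_indicator_sum[unfolded sets_neg_var, OF A]
          functional_measure_eq[OF A] sum_subtractf right_diff_distrib)
    have "l (qs_class M \<P> g) = ?I g"
      unfolding I_g unfolding g_def by (rule indicator_sum[OF S A])
    moreover have "\<bar>l (qs_class M \<P> (\<lambda>x. f x - g x))\<bar> \<le> K * e"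
      using approx \<open>e > 0\<close> by (intro bound_const) (auto simp: g_def)
    moreover have "\<bar>\<integral>x. f x - g x \<partial>\<mu>p\<bar> \<le> e * measure \<mu>p (space M)"
      using p.integral_abs_le_const(2)[of "\<lambda>x. f x - g x" e] approx by (simp add: g_def)
    moreover have "\<bar>\<integral>x. f x - g x \<partial>\<mu>n\<bar> \<le> e * measure \<mu>n (space M)"
      using n.integral_abs_le_const(2)[of "\<lambda>x. f x - g x" e] approx by (simp add: g_def)
    ultimately show ?thesis
      using int_f int_g diff_bounded_class[OF f bounded_class_in_M_c[OF f bdd] g g_bdd]
      by (simp add: C_def algebra_simps abs_le_iff)
  qed
  have "\<bar>l (qs_class M \<P> f) - ?I f\<bar> \<le> 0 + e" if "e > 0" for e
  proof -
    \<comment> \<open>\<open>C + 1\<close> instead of \<open>C\<close>, which may be 0.\<close>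
    have "e / (C + 1) * C \<le> e"
      using that \<open>C \<ge> 0\<close> by (simp add: field_simps)
    with close[of "e / (C + 1)"] that \<open>C \<ge> 0\<close> show ?thesis
      by simp
  qed
  then have "\<bar>l (qs_class M \<P> f) - ?I f\<bar> \<le> 0"
    by (rule field_le_epsilon)
  then show ?thesis
    by simp
qed

text \<open>For a Hahn set \<open>Y\<close>, \<open>\<mu>p\<close> vanishes off \<open>Y\<close> and
  \<open>\<mu>n\<close> vanishes on \<open>Y\<close>. Hence the integral equals \<open>l\<close> at
  the class of \<open>\<bar>f\<bar>\<close> restricted to \<open>Y\<close>, and the norm bound of
  \<open>l\<close> applies.\<close>

lemma integral_pos_var_le:
  assumes f [measurable]: "f \<in> borel_measurable M" and bdd: "bounded (f ` space M)"
  shows "(\<integral>x. \<bar>f x\<bar> \<partial>\<mu>p) \<le> K * enn2real (c_fun \<P> (\<lambda>x. \<bar>f x\<bar>))"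
proof -
  interpret p: finite_measure \<mu>p by (rule finite_\<mu>p)
  interpret n: finite_measure \<mu>n by (rule finite_\<mu>n)
  obtain Y where [measurable]: "Y \<in> sets M"
    and pos: "\<And>X. X \<in> sets M \<Longrightarrow> X \<subseteq> Y \<Longrightarrow> emeasure \<mu>n X \<le> emeasure \<mu>p X"
    and neg: "\<And>X. X \<in> sets M \<Longrightarrow> X \<inter> Y = {} \<Longrightarrow> emeasure \<mu>p X \<le> emeasure \<mu>n X"
    using finite_unsigned_Hahn_decomposition[OF finite_\<mu>p finite_\<mu>n] by auto
  \<comment> \<open>Every measurable subset of the complement has nonpositive signed measure, so the
    supremum defining the positive variation is 0 there.\<close>
  have "emeasure \<mu>p (space M - Y) \<le> 0"
    unfolding emeasure_pos_var[OF functional_measure_ca sets.compl_sets[OF \<open>Y \<in> sets M\<close>]]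
  proof (rule SUP_least, clarify)
    fix B assume "B \<in> sets M" "B \<subseteq> space M - Y"
    moreover from this have "B \<inter> Y = {}"
      by auto
    ultimately show "ennreal (functional_measure B) \<le> 0"
      using neg[of B] by (auto simp: functional_measure_eq p.emeasure_eq_measure n.emeasure_eq_measure ennreal_neg)
  qed
  then have "space M - Y \<in> null_sets \<mu>p"
    by (auto intro!: null_setsI)
  then have "AE x in \<mu>p. \<bar>f x\<bar> = \<bar>f x\<bar> * indicator Y x"
    by (rule AE_I') (auto simp: indicator_def)
  then have p_eq: "(\<integral>x. \<bar>f x\<bar> \<partial>\<mu>p) = (\<integral>x. \<bar>f x\<bar> * indicator Y x \<partial>\<mu>p)"
    by (intro integral_cong_AE) auto
  have "emeasure \<mu>n Y \<le> 0"
    unfolding neg_var_def emeasure_pos_var[OF ca_uminus[OF functional_measure_ca] \<open>Y \<in> sets M\<close>]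
  proof (rule SUP_least, clarify)
    fix B assume "B \<in> sets M" "B \<subseteq> Y"
    then show "ennreal (- functional_measure B) \<le> 0"
      using pos[of B] by (auto simp: functional_measure_eq p.emeasure_eq_measure n.emeasure_eq_measure ennreal_neg)
  qed
  then have "Y \<in> null_sets \<mu>n"
    by (auto intro!: null_setsI)
  then have "AE x in \<mu>n. \<bar>f x\<bar> * indicator Y x = 0"
    by (rule AE_I') (auto simp: indicator_def)
  then have n_eq: "(\<integral>x. \<bar>f x\<bar> * indicator Y x \<partial>\<mu>n) = 0"
    by (rule integral_eq_zero_AE)
  have bdd': "bounded ((\<lambda>x. \<bar>f x\<bar> * indicator Y x) ` space M)"
  proof -
    obtain b where b: "\<And>x. x \<in> space M \<Longrightarrow> \<bar>f x\<bar> \<le> b"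
      using bdd by (auto simp: bounded_iff)
    have "\<bar>f x\<bar> * indicator Y x \<le> b" if "x \<in> space M" for x
      using b[OF that] by (auto simp: indicator_def)
    then show ?thesis
      by (intro boundedI[of _ b]) auto
  qed
  have "(\<integral>x. \<bar>f x\<bar> \<partial>\<mu>p) = l (qs_class M \<P> (\<lambda>x. \<bar>f x\<bar> * indicator Y x))"
    using bdd' by (simp add: bounded_class_eq_integral p_eq n_eq)
  also have "\<dots> \<le> K * enn2real (c_fun \<P> (\<lambda>x. \<bar>\<bar>f x\<bar> * indicator Y x\<bar>))"
    using bdd' by (intro order.trans[OF abs_ge_self bound_class] bounded_class_in_M_c) auto
  also have "\<dots> \<le> K * enn2real (c_fun \<P> (\<lambda>x. \<bar>f x\<bar>))"
    using K_nonneg c_fun_abs_finite[OF bdd]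
    by (intro mult_left_mono enn2real_mono c_fun_mono) (auto simp: indicator_def)
  finally show ?thesis .
qed

text \<open>The bound for the truncations of \<open>\<bar>f\<bar>\<close> at \<open>n\<close> is
  uniform in \<open>n\<close>; monotone convergence carries it to
  \<open>\<bar>f\<bar>\<close>.\<close>

lemma pos_var_integrable:
  assumes f [measurable]: "f \<in> borel_measurable M" and fin: "c_fun \<P> (\<lambda>x. \<bar>f x\<bar>) < \<infinity>"
  shows "integrable \<mu>p f" and "\<bar>\<integral>x. f x \<partial>\<mu>p\<bar> \<le> K * enn2real (c_fun \<P> (\<lambda>x. \<bar>f x\<bar>))"
proof -
  interpret p: finite_measure \<mu>p by (rule finite_\<mu>p)
  let ?b = "K * enn2real (c_fun \<P> (\<lambda>x. \<bar>f x\<bar>))" and ?g = "\<lambda>n x. min \<bar>f x\<bar> (real n)"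
  have "(\<integral>\<^sup>+x. ennreal (?g n x) \<partial>\<mu>p) \<le> ennreal ?b" for n
  proof -
    have bdd: "bounded (?g n ` space M)"
      by (rule boundedI[of _ "real n"]) auto
    then have "integrable \<mu>p (?g n)"
      by (intro p.integral_abs_le_const(1)[of _ "real n"]) auto
    then have "(\<integral>\<^sup>+x. ennreal (?g n x) \<partial>\<mu>p) = ennreal (\<integral>x. \<bar>?g n x\<bar> \<partial>\<mu>p)"
      by (subst nn_integral_eq_integral) auto
    also have "(\<integral>x. \<bar>?g n x\<bar> \<partial>\<mu>p) \<le> K * enn2real (c_fun \<P> (\<lambda>x. \<bar>?g n x\<bar>))"
      by (rule integral_pos_var_le[OF _ bdd]) auto
    also have "\<dots> \<le> ?b"
      using K_nonneg fin by (intro mult_left_mono enn2real_mono c_fun_mono) auto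
    finally show ?thesis
      by (simp add: ennreal_leI)
  qed
  moreover have "(\<lambda>n. \<integral>\<^sup>+x. ennreal (?g n x) \<partial>\<mu>p) \<longlonglongrightarrow> (\<integral>\<^sup>+x. ennreal \<bar>f x\<bar> \<partial>\<mu>p)"
  proof (rule nn_integral_LIMSEQ)
    show "incseq (\<lambda>n x. ennreal (?g n x))"
      by (auto simp: incseq_def le_fun_def intro!: ennreal_leI)
    show "(\<lambda>n. ennreal (?g n x)) \<longlonglongrightarrow> ennreal \<bar>f x\<bar>" for x
    proof (rule tendsto_eventually)
      show "\<forall>\<^sub>F n in sequentially. ennreal (?g n x) = ennreal \<bar>f x\<bar>"
        using eventually_ge_at_top[of "nat \<lceil>\<bar>f x\<bar>\<rceil>"]
        by eventually_elim (auto simp: min_def nat_le_iff ceiling_le_iff)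
    qed
  qed auto
  ultimately have le: "(\<integral>\<^sup>+x. ennreal \<bar>f x\<bar> \<partial>\<mu>p) \<le> ennreal ?b"
    by (intro LIMSEQ_le_const2) auto
  then show int: "integrable \<mu>p f"
    using ennreal_less_top[of ?b] by (auto simp: integrable_iff_bounded intro: le_less_trans)
  have "\<bar>\<integral>x. f x \<partial>\<mu>p\<bar> \<le> (\<integral>x. \<bar>f x\<bar> \<partial>\<mu>p)"
    by (rule integral_abs_bound)
  also have "ennreal (\<integral>x. \<bar>f x\<bar> \<partial>\<mu>p) \<le> ennreal ?b"
    using le int by (subst nn_integral_eq_integral[symmetric]) auto
  then have "(\<integral>x. \<bar>f x\<bar> \<partial>\<mu>p) \<le> ?b"
    using K_nonneg by (subst (asm) ennreal_le_iff) auto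
  finally show "\<bar>\<integral>x. f x \<partial>\<mu>p\<bar> \<le> ?b" .
qed

lemma M_c_functional_uminus: "M_c_functional M \<P> (\<lambda>X. - l X) K"
  by unfold_locales (use add scale bound K_nonneg Z_empty in auto)

lemma neg_var_eq: "\<mu>n = pos_var M (M_c_functional.functional_measure M \<P> (\<lambda>X. - l X))"
proof -
  have "M_c_functional.functional_measure M \<P> (\<lambda>X. - l X) = (\<lambda>A. - functional_measure A)"
    by (rule ext)
      (simp add: M_c_functional.functional_measure_def[OF M_c_functional_uminus] functional_measure_def)
  then show ?thesis
    by (simp only: neg_var_def)
qed

lemma neg_var_integrable:
  assumes "f \<in> borel_measurable M" and "c_fun \<P> (\<lambda>x. \<bar>f x\<bar>) < \<infinity>"
  shows "integrable \<mu>n f" and "\<bar>\<integral>x. f x \<partial>\<mu>n\<bar> \<le> K * enn2real (c_fun \<P> (\<lambda>x. \<bar>f x\<bar>))"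
  unfolding neg_var_eq
  by (rule M_c_functional.pos_var_integrable[OF M_c_functional_uminus assms])+

text \<open>Both sides are continuous for \<open>norm_c\<close> and agree on bounded functions,
  which are dense in \<open>M_c\<close>.\<close>

lemma has_signed_integral_class:
  assumes f [measurable]: "f \<in> borel_measurable M" and f_M_c: "qs_class M \<P> f \<in> M_c M \<P>"
  shows "has_signed_integral M functional_measure f (l (qs_class M \<P> f))"
proof -
  let ?I = "\<lambda>f. (\<integral>x. f x \<partial>\<mu>p) - (\<integral>x. f x \<partial>\<mu>n)"
  have fin: "c_fun \<P> (\<lambda>x. \<bar>f x\<bar>) < \<infinity>"
    using f_M_c by (simp add: M_c_class_iff)
  have "\<bar>l (qs_class M \<P> f) - ?I f\<bar> \<le> 0 + e" if "e > 0" for e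
  proof -
    \<comment> \<open>Three errors of at most \<open>K\<close> times the distance arise, from
      \<open>l\<close>, \<open>\<mu>p\<close> and \<open>\<mu>n\<close>; the summand 1 keeps the
      denominator positive when \<open>K\<close> is 0.\<close>
    obtain g where g [measurable]: "g \<in> borel_measurable M" and g_bdd: "bounded (g ` space M)"
      and close: "enn2real (c_fun \<P> (\<lambda>x. \<bar>f x - g x\<bar>)) < e / (3 * K + 1)"
      using f_M_c \<open>e > 0\<close> K_nonneg by (auto simp: M_c_class_iff elim!: allE[of _ "e / (3 * K + 1)"])
    let ?d = "enn2real (c_fun \<P> (\<lambda>x. \<bar>f x - g x\<bar>))"
    have d_M_c: "qs_class M \<P> (\<lambda>x. f x - g x) \<in> M_c M \<P>"
      by (rule M_c_diff_bounded[OF f g f_M_c g_bdd])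
    then have d_fin: "c_fun \<P> (\<lambda>x. \<bar>f x - g x\<bar>) < \<infinity>"
      by (simp add: M_c_class_iff)
    have "\<bar>l (qs_class M \<P> (\<lambda>x. f x - g x))\<bar> \<le> K * ?d"
      by (rule bound_class[OF _ d_M_c]) measurable
    moreover have "\<bar>\<integral>x. f x - g x \<partial>\<mu>p\<bar> \<le> K * ?d" "\<bar>\<integral>x. f x - g x \<partial>\<mu>n\<bar> \<le> K * ?d"
      by (rule pos_var_integrable(2)[OF _ d_fin] neg_var_integrable(2)[OF _ d_fin], measurable)+
    moreover have "l (qs_class M \<P> g) = ?I g"
      by (rule bounded_class_eq_integral[OF g g_bdd])
    moreover have "3 * (K * ?d) + ?d < e"
      using close K_nonneg by (simp add: pos_less_divide_eq algebra_simps)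
    moreover have "0 \<le> ?d"
      by simp
    moreover have "(\<integral>x. f x - g x \<partial>\<mu>p) = (\<integral>x. f x \<partial>\<mu>p) - (\<integral>x. g x \<partial>\<mu>p)"
      by (intro Bochner_Integration.integral_diff pos_var_integrable(1) f g fin c_fun_abs_finite g_bdd)
    moreover have "(\<integral>x. f x - g x \<partial>\<mu>n) = (\<integral>x. f x \<partial>\<mu>n) - (\<integral>x. g x \<partial>\<mu>n)"
      by (intro Bochner_Integration.integral_diff neg_var_integrable(1) f g fin c_fun_abs_finite g_bdd)
    ultimately show ?thesis
      using diff_bounded_class[OF f f_M_c g g_bdd] by linarith
  qed
  then have "\<bar>l (qs_class M \<P> f) - ?I f\<bar> \<le> 0"
    by (rule field_le_epsilon)
  then show ?thesis
    using pos_var_integrable(1)[OF f fin] neg_var_integrable(1)[OF f fin]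
    by (simp add: has_signed_integral_def)
qed

end

lemma (in prob_family) dual_in_ca_M_c:
  assumes Z: "Z_seqs M \<P> = {}"
  shows "dual_in_ca M \<P> (M_c M \<P>)"
  unfolding dual_in_ca_def
proof
  fix l assume l: "l \<in> norm_dual M \<P> (M_c M \<P>)"
  then obtain K where K: "\<And>X. X \<in> M_c M \<P> \<Longrightarrow> \<bar>l X\<bar> \<le> K * norm_c \<P> X"
    unfolding norm_dual_def by blast
  \<comment> \<open>The constant supplied by \<open>norm_dual\<close> carries no sign, whereas the
    locale asks for a nonnegative one.\<close>
  have K': "\<bar>l X\<bar> \<le> max K 0 * norm_c \<P> X" if "X \<in> M_c M \<P>" for X
    by (rule order.trans[OF K[OF that]]) (auto simp: norm_c_def intro!: mult_right_mono)
  interpret M_c_functional M \<P> l "max K 0"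
    by unfold_locales (use l K' Z in \<open>auto simp: norm_dual_def\<close>)
  have "has_signed_integral M functional_measure f (l X)" if X: "X \<in> M_c M \<P>" and f: "f \<in> X" for X f
  proof -
    \<comment> \<open>Any representative \<open>f\<close> generates the class \<open>X\<close>, so
      the identity for \<open>qs_class M \<P> f\<close> covers all of them.\<close>
    obtain g where "X = qs_class M \<P> g"
      using X M_c_subset_H_c by (auto elim: H_c_E)
    then have "f \<in> borel_measurable M" "X = qs_class M \<P> f"
      using f qs_class_mem_eq by (auto simp: mem_qs_class)
    with X show ?thesis
      by (simp add: has_signed_integral_class)
  qed
  with functional_measure_ca
  show "\<exists>\<mu>\<in>ca M. \<forall>X\<in>M_c M \<P>. \<forall>f\<in>X. has_signed_integral M \<mu> f (l X)"
    by blast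
qed

subsection \<open>Domination\<close>

context prob_family
begin

text \<open>The intersection of the tail unions is exactly \<open>limsup A\<close>. With it removed
  they decrease to the empty set, and \<open>P n\<close> does not notice the removal.\<close>

lemma emeasure_tendsto_0_of_limsup_null:
  assumes Z: "Z_seqs M \<P> = {}" and A [measurable]: "\<And>n::nat. A n \<in> sets M"
    and null: "\<And>n. emeasure (P n) (limsup A) = 0" and P: "\<And>n. P n \<in> \<P>"
  shows "(\<lambda>n. emeasure (P n) (A n)) \<longlonglongrightarrow> 0"
proof -
  define B where "B n = (\<Union>k\<in>{n..}. A k) - limsup A" for n
  have B [measurable]: "B n \<in> sets M" for n
    unfolding B_def by measurable
  have "(\<Inter>n. B n) = {}"
    by (auto simp: B_def limsup_INF_SUP)
  moreover have "decseq B"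
    unfolding decseq_def B_def by (intro allI impI Diff_mono UN_mono) auto
  ultimately have lim: "(\<lambda>n. c_set \<P> (B n)) \<longlonglongrightarrow> 0"
    using B by (intro c_set_tendsto_0 Z) auto
  have le: "emeasure (P n) (A n) \<le> c_set \<P> (B n)" for n
  proof -
    have sets: "A n \<in> sets (P n)" "B n \<in> sets (P n)" "limsup A \<in> sets (P n)"
      by (simp_all add: sets_eq[OF P])
    have "emeasure (P n) (A n) \<le> emeasure (P n) (B n \<union> limsup A)"
      by (rule emeasure_mono[OF _ sets.Un[OF sets(2,3)]]) (auto simp: B_def)
    also have "\<dots> \<le> emeasure (P n) (B n) + emeasure (P n) (limsup A)"
      using sets by (intro emeasure_subadditive)
    also have "\<dots> = emeasure (P n) (B n)"
      by (simp add: null)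
    also have "\<dots> \<le> c_set \<P> (B n)"
      unfolding c_set_eq[OF B] using P by (rule SUP_upper)
    finally show ?thesis .
  qed
  show ?thesis
    by (rule tendsto_sandwich[OF _ _ tendsto_const lim]) (use le in auto)
qed

text \<open>Otherwise every finite \<open>F\<close> admits a set null for all of \<open>F\<close>
  and a measure in \<open>\<P>\<close> giving it more than \<open>\<epsilon>\<close>. Adding that
  measure to \<open>F\<close> and repeating produces a sequence that contradicts the preceding
  lemma.\<close>

lemma finite_subset_controls_c_set:
  assumes Z: "Z_seqs M \<P> = {}" and "\<epsilon> > 0"
  shows "\<exists>F\<subseteq>\<P>. finite F \<and>
    (\<forall>A\<in>sets M. (\<forall>P\<in>F. emeasure P A = 0) \<longrightarrow> c_set \<P> A \<le> \<epsilon>)"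
proof (rule ccontr)
  assume contra: "\<not> ?thesis"
  have "\<exists>A P. A \<in> sets M \<and> P \<in> \<P> \<and> (\<forall>Q\<in>F. emeasure Q A = 0) \<and> \<epsilon> < emeasure P A"
    if "finite F" "F \<subseteq> \<P>" for F
  proof -
    obtain A where A: "A \<in> sets M" "\<forall>Q\<in>F. emeasure Q A = 0" "\<epsilon> < c_set \<P> A"
      using contra \<open>finite F\<close> \<open>F \<subseteq> \<P>\<close> by (auto simp: not_le)
    then show ?thesis
      by (auto simp: c_set_eq less_SUP_iff)
  qed
  then obtain A P where AP: "\<And>F. finite F \<Longrightarrow> F \<subseteq> \<P> \<Longrightarrow>
      A F \<in> sets M \<and> P F \<in> \<P> \<and> (\<forall>Q\<in>F. emeasure Q (A F) = 0) \<and> \<epsilon> < emeasure (P F) (A F)"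
    by metis
  \<comment> \<open>\<open>F n\<close> holds the measures chosen before stage \<open>n\<close>, so
    \<open>A (F n)\<close> is null for each of them.\<close>
  define F where "F = rec_nat {} (\<lambda>_ F. insert (P F) F)"
  have F_0: "F 0 = {}" and F_Suc: "F (Suc n) = insert (P (F n)) (F n)" for n
    by (simp_all add: F_def)
  have F: "finite (F n) \<and> F n \<subseteq> \<P>" for n
    by (induction n) (use AP in \<open>auto simp: F_0 F_Suc\<close>)
  have A_sets [measurable]: "A (F n) \<in> sets M" and P_mem: "P (F n) \<in> \<P>"
    and null: "Q \<in> F n \<Longrightarrow> emeasure Q (A (F n)) = 0"
    and large: "\<epsilon> < emeasure (P (F n)) (A (F n))" for n Q
    using AP[of "F n"] F[of n] by auto
  have "P (F k) \<in> F n" if "k < n" for k n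
    using that by (induction n) (auto simp: F_Suc less_Suc_eq)
  then have P_null: "emeasure (P (F k)) (A (F n)) = 0" if "k < n" for k n
    using that by (intro null)
  have "emeasure (P (F k)) (limsup (\<lambda>n. A (F n))) = 0" for k
  proof -
    have sets: "A (F n) \<in> sets (P (F k))" for n
      by (simp add: sets_eq[OF P_mem])
    \<comment> \<open>The tail starts at \<open>Suc k\<close> because \<open>P (F k)\<close> is
      known to vanish only on sets chosen after stage \<open>k\<close>.\<close>
    have "limsup (\<lambda>n. A (F n)) \<subseteq> (\<Union>n\<in>{Suc k..}. A (F n))"
      by (auto simp: limsup_INF_SUP)
    moreover have null_Un: "(\<Union>n\<in>{Suc k..}. A (F n)) \<in> null_sets (P (F k))"
      using P_null sets by (intro null_sets_UN') (auto intro!: null_setsI)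
    ultimately have "emeasure (P (F k)) (limsup (\<lambda>n. A (F n))) \<le>
        emeasure (P (F k)) (\<Union>n\<in>{Suc k..}. A (F n))"
      by (intro emeasure_mono null_setsD2)
    with null_setsD1[OF null_Un] show ?thesis
      by simp
  qed
  then have "(\<lambda>n. emeasure (P (F n)) (A (F n))) \<longlonglongrightarrow> 0"
    using P_mem by (intro emeasure_tendsto_0_of_limsup_null Z) auto
  then have "\<epsilon> \<le> 0"
    using large by (intro LIMSEQ_le_const) (auto intro: less_imp_le)
  with \<open>\<epsilon> > 0\<close> show False
    by simp
qed

text \<open>Unite the finite sets controlling the levels \<open>1 / (n + 1)\<close>: a set null for
  the union has capacity below every level, hence 0.\<close>

lemma countable_equivalent:
  assumes Z: "Z_seqs M \<P> = {}"
  obtains \<P>' where "\<P>' \<subseteq> \<P>" "countable \<P>'" "\<P>' \<noteq> {}" "equivalent M \<P>' \<P>"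
proof -
  have "\<exists>F\<subseteq>\<P>. finite F \<and>
      (\<forall>A\<in>sets M. (\<forall>P\<in>F. emeasure P A = 0) \<longrightarrow> c_set \<P> A \<le> ennreal (inverse (real (Suc n))))" for n
    by (rule finite_subset_controls_c_set[OF Z]) simp
  then obtain F where F: "\<And>n. F n \<subseteq> \<P>" "\<And>n. finite (F n)"
    and small: "\<And>n A. A \<in> sets M \<Longrightarrow> (\<And>P. P \<in> F n \<Longrightarrow> emeasure P A = 0) \<Longrightarrow>
      c_set \<P> A \<le> ennreal (inverse (real (Suc n)))"
    by metis
  obtain P\<^sub>0 where P0: "P\<^sub>0 \<in> \<P>"
    using nonempty by auto
  \<comment> \<open>Inserting \<open>P\<^sub>0\<close> guarantees a nonempty family, which can then
    be enumerated for the mixture.\<close>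
  define \<P>' where "\<P>' = insert P\<^sub>0 (\<Union>n. F n)"
  have "\<P>' \<subseteq> \<P>" "countable \<P>'" "\<P>' \<noteq> {}"
    using F P0 by (auto simp: \<P>'_def intro!: countable_UN intro: countable_finite)
  moreover have "equivalent M \<P>' \<P>"
    unfolding equivalent_def dominated_def
  proof (intro conjI ballI impI)
    fix A assume A: "A \<in> sets M" "(SUP P\<in>\<P>. emeasure P A) = 0"
    have "(SUP P\<in>\<P>'. emeasure P A) \<le> (SUP P\<in>\<P>. emeasure P A)"
      using \<open>\<P>' \<subseteq> \<P>\<close> by (rule SUP_subset_mono) simp
    with A(2) show "(SUP P\<in>\<P>'. emeasure P A) = 0"
      by simp
  next
    fix A assume A: "A \<in> sets M" "(SUP P\<in>\<P>'. emeasure P A) = 0"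
    have "emeasure P A = 0" if "P \<in> \<P>'" for P
      using SUP_upper[OF that, of "\<lambda>P. emeasure P A"] A(2) by simp
    then have "c_set \<P> A \<le> ennreal (inverse (real (Suc n)))" for n
      by (intro small A(1)) (auto simp: \<P>'_def)
    moreover have "(\<lambda>n. ennreal (inverse (real (Suc n)))) \<longlonglongrightarrow> 0"
      using tendsto_ennrealI[OF LIMSEQ_inverse_real_of_nat] by simp
    ultimately have "c_set \<P> A \<le> 0"
      by (intro LIMSEQ_le_const) auto
    then show "(SUP P\<in>\<P>. emeasure P A) = 0"
      using A(1) by (simp add: c_set_eq)
  qed
  ultimately show thesis
    by (rule that)
qed

text \<open>\<open>Q\<close> is a countable mixture with strictly positive weights, so its null sets
  are the common null sets of \<open>\<P>'\<close>. Writing it as a monadic bind provides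
  measurability and total mass 1.\<close>

lemma prob_measure_equivalent:
  assumes sub: "\<P>' \<subseteq> \<P>" "countable \<P>'" "\<P>' \<noteq> {}" and eq: "equivalent M \<P>' \<P>"
  shows "\<exists>Q\<in>space (prob_algebra M). equivalent M {Q} \<P>"
proof -
  \<comment> \<open>The enumeration has range \<open>\<P>'\<close>, with repetitions if
    \<open>\<P>'\<close> is finite, and the geometric distribution charges every index.\<close>
  let ?P = "from_nat_into \<P>'" and ?G = "measure_pmf (geometric_pmf (1 / 2))"
  have range: "range ?P = \<P>'"
    using sub by (intro range_from_nat_into)
  have kernel: "?P \<in> ?G \<rightarrow>\<^sub>M prob_algebra M"
    using range sub(1) prob_algebra by (auto simp: measurable_def)
  have G: "?G \<in> space (prob_algebra ?G)"
    by (simp add: space_prob_algebra measure_pmf.prob_space_axioms)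
  define Q where "Q = ?G \<bind> ?P"
  have "Q \<in> space (prob_algebra M)"
    unfolding Q_def using prob_space_bind'[OF G kernel] sets_bind'[OF G kernel]
    by (simp add: space_prob_algebra)
  moreover have "emeasure Q A = 0 \<longleftrightarrow> (SUP P\<in>\<P>'. emeasure P A) = 0" if "A \<in> sets M" for A
  proof -
    have "emeasure Q A = 0 \<longleftrightarrow> (\<forall>n. emeasure (?P n) A = 0)"
      unfolding Q_def emeasure_bind_prob_algebra[OF G kernel that]
      by (subst nn_integral_0_iff_AE) (auto simp: AE_measure_pmf_iff set_pmf_geometric)
    also have "\<dots> \<longleftrightarrow> (\<forall>P\<in>\<P>'. emeasure P A = 0)"
      using range by (metis rangeE rangeI)
    also have "\<dots> \<longleftrightarrow> (SUP P\<in>\<P>'. emeasure P A) = 0"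
      using sub(3) by (simp add: SUP_eq_iff)
    finally show ?thesis .
  qed
  ultimately show ?thesis
    using eq by (intro bexI[of _ Q]) (auto simp: equivalent_def dominated_def)
qed

end

theorem theorem3p1:
  fixes M :: "'a measure" and \<P> :: "'a measure set"
  assumes "\<P> \<noteq> {}" and "\<P> \<subseteq> space (prob_algebra M)"
  shows "(Z_seqs M \<P> = {} \<longleftrightarrow> dual_in_ca M \<P> (M_c M \<P>))
    \<and> (dual_in_ca M \<P> (H_c M \<P>) \<longrightarrow> Z_seqs M \<P> = {})
    \<and> (Z_seqs M \<P> = {} \<longrightarrow>
         (\<exists>\<P>'\<subseteq>\<P>. countable \<P>' \<and> equivalent M \<P>' \<P>)
         \<and> (\<exists>Q\<in>space (prob_algebra M). equivalent M {Q} \<P>))"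
proof -
  interpret prob_family M \<P>
    by unfold_locales (use assms in auto)
  have M_c: "dual_in_ca M \<P> (M_c M \<P>) \<Longrightarrow> Z_seqs M \<P> = {}"
    by (rule Z_seqs_empty_if_dual_in_ca[OF L_inf_c_subset_M_c M_c_subset_H_c])
  have H_c: "dual_in_ca M \<P> (H_c M \<P>) \<Longrightarrow> Z_seqs M \<P> = {}"
    by (rule Z_seqs_empty_if_dual_in_ca[OF order.trans[OF L_inf_c_subset_M_c M_c_subset_H_c] order.refl])
  have "(\<exists>\<P>'\<subseteq>\<P>. countable \<P>' \<and> equivalent M \<P>' \<P>)
      \<and> (\<exists>Q\<in>space (prob_algebra M). equivalent M {Q} \<P>)" if Z: "Z_seqs M \<P> = {}"
  proof -
    from countable_equivalent[OF Z] obtain \<P>' where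
      \<P>': "\<P>' \<subseteq> \<P>" "countable \<P>'" "\<P>' \<noteq> {}" "equivalent M \<P>' \<P>" .
    with prob_measure_equivalent[OF \<P>'] show ?thesis
      by blast
  qed
  with M_c H_c dual_in_ca_M_c show ?thesis
    by blast
qed

end
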